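(* Let the scalar field be $\mathbb{C}$ and let $K$ be a compact Hausdorff space. Then $K$ contains a perfect set if and only if $C(K)$ contains an isometric SPR copy of every separable Banach space, i.e. for every separable complex Banach space $X$ there is a linear isometric embedding $X\to C(K)$ whose range does SPR.
   Context: A perfect set in a topological space is a nonempty closed subset with no isolated points (in its subspace topology). $C(K)$ is the space of complex-valued continuous functions on $K$ with the supremum norm. A complex linear subspace $E$ of $C(K)$ does SPR (stable phase retrieval) if there is a constant $C\ge1$ such that $\inf_{\lambda\in\mathbb{C},|\lambda|=1}\|f-\lambda g\|\le C\,\big\||f|-|g|\big\|$ for all $f,g\in E$. *)

theory Defs
  imports "HOL-Analysis.Analysis" "HOL-Algebra.Module"
begin

definition perfect_set_in :: "'a topology \<Rightarrow> 'a set \<Rightarrow> bool" where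
  "perfect_set_in K P \<longleftrightarrow>
     closedin K P \<and> P \<noteq> {} \<and> (\<forall>x\<in>P. \<not> openin (subtopology K P) {x})"


section \<open>Complex Banach spaces with an explicit carrier\<close>

text \<open>
  The main statement quantifies over all separable Banach spaces inside one side of an
  equivalence, which type classes do not permit. Spaces are therefore records: a complex vector
  space is a module (in the sense of HOL-Algebra) over the field of complex numbers. The fields
  mult and one inherited from rings play no role for modules and are unconstrained.

  A quantifier inside a formula also fixes the type of the carriers. Carriers inside the type
  of complex sequences lose nothing: a separable Banach space has at most as many elements as
  there are complex sequences, so its structure can be transported along an injection into
  that type.
\<close>

definition complex_ring :: "complex ring" where
  "complex_ring = \<lparr>carrier = UNIV, mult = (*), one = 1, zero = 0, add = (+)\<rparr>"

record 'v normed_module = "(complex, 'v) module" +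
  vnorm :: "'v \<Rightarrow> real"

locale complex_normed_space = module complex_ring V
  for V :: "'v normed_module" (structure) +
  assumes vnorm_eq_0_iff: "x \<in> carrier V \<Longrightarrow> vnorm V x = 0 \<longleftrightarrow> x = \<zero>\<^bsub>V\<^esub>"
    and vnorm_smult: "x \<in> carrier V \<Longrightarrow> vnorm V (c \<odot>\<^bsub>V\<^esub> x) = cmod c * vnorm V x"
    and vnorm_triangle:
      "x \<in> carrier V \<Longrightarrow> y \<in> carrier V \<Longrightarrow> vnorm V (x \<oplus>\<^bsub>V\<^esub> y) \<le> vnorm V x + vnorm V y"

text \<open>
  The value 0 off the carrier is there because \<^locale>\<open>Metric_space\<close> demands nonnegativity and symmetry
  of the distance on the whole type.
\<close>

definition vdist :: "'v normed_module \<Rightarrow> 'v \<Rightarrow> 'v \<Rightarrow> real" where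
  "vdist V x y =
     (if x \<in> carrier V \<and> y \<in> carrier V then vnorm V (x \<ominus>\<^bsub>V\<^esub> y) else 0)"

lemma complex_normed_space_Metric_space:
  assumes "complex_normed_space V"
  shows "Metric_space (carrier V) (vdist V)"
proof -
  interpret complex_normed_space V by fact
  have minus: "\<ominus>\<^bsub>V\<^esub> x = (-1) \<odot>\<^bsub>V\<^esub> x" if "x \<in> carrier V" for x
  proof -
    have "\<one>\<^bsub>complex_ring\<^esub> \<oplus>\<^bsub>complex_ring\<^esub> (-1) = \<zero>\<^bsub>complex_ring\<^esub>"
      by (simp add: complex_ring_def)
    then have "x \<oplus>\<^bsub>V\<^esub> (-1) \<odot>\<^bsub>V\<^esub> x = \<zero>\<^bsub>V\<^esub>"
      using that smult_l_distr[of "1" "-1" x] smult_one[OF that] smult_l_null[OF that]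
      by (simp add: complex_ring_def)
    moreover have "(-1) \<odot>\<^bsub>V\<^esub> x \<in> carrier V"
      using that by (simp add: complex_ring_def)
    ultimately show ?thesis
      using that by (metis M.minus_equality M.a_comm)
  qed
  have vminus: "vnorm V (\<ominus>\<^bsub>V\<^esub> x) = vnorm V x" if "x \<in> carrier V" for x
    using that vnorm_smult[of x "-1"] by (simp add: minus)
  have nonneg: "0 \<le> vnorm V x" if "x \<in> carrier V" for x
    using that vnorm_triangle[of x "\<ominus>\<^bsub>V\<^esub> x"] vminus[OF that] vnorm_eq_0_iff[of "\<zero>\<^bsub>V\<^esub>"]
    by (simp add: M.r_neg)
  show ?thesis
  proof
    show "0 \<le> vdist V x y" for x y
      by (simp add: vdist_def nonneg)
    show "vdist V x y = vdist V y x" for x y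
      using vminus[of "x \<ominus>\<^bsub>V\<^esub> y"]
      by (auto simp: vdist_def M.minus_eq M.minus_add M.a_comm)
    show "vdist V x y = 0 \<longleftrightarrow> x = y" if "x \<in> carrier V" "y \<in> carrier V" for x y
    proof
      assume "vdist V x y = 0"
      then have "x \<oplus>\<^bsub>V\<^esub> \<ominus>\<^bsub>V\<^esub> y = \<zero>\<^bsub>V\<^esub>"
        using that by (simp add: vdist_def vnorm_eq_0_iff M.minus_eq)
      then show "x = y"
        using that M.minus_equality[of x "\<ominus>\<^bsub>V\<^esub> y"] by simp
    qed (use that in \<open>simp add: vdist_def vnorm_eq_0_iff M.minus_eq M.r_neg\<close>)
    show "vdist V x z \<le> vdist V x y + vdist V y z"
      if "x \<in> carrier V" "y \<in> carrier V" "z \<in> carrier V" for x y z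
    proof -
      have "x \<ominus>\<^bsub>V\<^esub> z = (x \<ominus>\<^bsub>V\<^esub> y) \<oplus>\<^bsub>V\<^esub> (y \<ominus>\<^bsub>V\<^esub> z)"
        using that by (simp add: M.minus_eq M.a_assoc M.r_neg1)
      then show ?thesis
        using that vnorm_triangle[of "x \<ominus>\<^bsub>V\<^esub> y" "y \<ominus>\<^bsub>V\<^esub> z"] by (simp add: vdist_def)
    qed
  qed
qed

definition separable_complex_banach :: "'v normed_module \<Rightarrow> bool" where
  "separable_complex_banach V \<longleftrightarrow>
     complex_normed_space V \<and>
     Metric_space.mcomplete (carrier V) (vdist V) \<and>
     separable_space (Metric_space.mtopology (carrier V) (vdist V))"

definition linear_isometry :: "'v normed_module \<Rightarrow> 'w normed_module \<Rightarrow> ('v \<Rightarrow> 'w) \<Rightarrow> bool" where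
  "linear_isometry V W T \<longleftrightarrow>
     T \<in> carrier V \<rightarrow> carrier W \<and>
     (\<forall>x\<in>carrier V. \<forall>y\<in>carrier V. T (x \<oplus>\<^bsub>V\<^esub> y) = T x \<oplus>\<^bsub>W\<^esub> T y) \<and>
     (\<forall>c. \<forall>x\<in>carrier V. T (c \<odot>\<^bsub>V\<^esub> x) = c \<odot>\<^bsub>W\<^esub> T x) \<and>
     (\<forall>x\<in>carrier V. vnorm W (T x) = vnorm V x)"


section \<open>The space C(K)\<close>

text \<open>
  The supremum over the empty set of reals is unspecified in the library; the supremum norm on
  the zero space of functions on the empty space is 0.
\<close>

definition sup_norm :: "'a topology \<Rightarrow> ('a \<Rightarrow> complex) \<Rightarrow> real" where
  "sup_norm K f = (if topspace K = {} then 0 else (SUP x\<in>topspace K. cmod (f x)))"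

text \<open>
  Functions on the topological space are represented by functions on the type that are
  extensional (undefined off the space), so that equality is equality on the space.
\<close>

definition C_space :: "'a topology \<Rightarrow> ('a \<Rightarrow> complex) normed_module" where
  "C_space K =
     \<lparr>carrier = {f \<in> extensional (topspace K). continuous_map K euclidean f},
      mult = (\<lambda>f g. \<lambda>x\<in>topspace K. f x * g x),
      one = (\<lambda>x\<in>topspace K. 1),
      zero = (\<lambda>x\<in>topspace K. 0),
      add = (\<lambda>f g. \<lambda>x\<in>topspace K. f x + g x),
      smult = (\<lambda>c f. \<lambda>x\<in>topspace K. c * f x),
      vnorm = sup_norm K\<rparr>"

lemma C_space_complex_normed_space:
  assumes "compact_space K"
  shows "complex_normed_space (C_space K)"
proof -
  have bdd: "bdd_above ((\<lambda>x. cmod (f x)) ` topspace K)" if "continuous_map K euclidean f" for f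
  proof -
    have "compactin euclidean (f ` topspace K)"
      using assms that image_compactin unfolding compact_space_def by blast
    then have "bounded (f ` topspace K)"
      by (simp add: compact_imp_bounded)
    then show ?thesis
      by (auto simp: bounded_iff bdd_above_def)
  qed
  have le: "cmod (f x) \<le> sup_norm K f"
    if "continuous_map K euclidean f" "x \<in> topspace K" for f x
    using cSUP_upper[OF that(2) bdd[OF that(1)]] that(2) by (auto simp: sup_norm_def)
  have least: "sup_norm K f \<le> B" if "\<And>x. x \<in> topspace K \<Longrightarrow> cmod (f x) \<le> B" "0 \<le> B" for f B
    using that by (auto simp: sup_norm_def intro: cSUP_least)
  have ge0: "0 \<le> sup_norm K f" if "continuous_map K euclidean f" for f
  proof (cases "topspace K = {}")
    case True
    then show ?thesis by (simp add: sup_norm_def)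
  next
    case False
    then show ?thesis using le[OF that] norm_ge_zero order_trans by blast
  qed
  have cont [simp]: "continuous_map K euclidean (restrict f (topspace K)) \<longleftrightarrow> continuous_map K euclidean f"
    for f :: "'a \<Rightarrow> complex"
    by (auto elim: continuous_map_eq)
  have cont_mult: "continuous_map K euclidean (\<lambda>x. c * f x)"
    if "continuous_map K euclidean f" for c :: complex and f
    using that by (simp add: continuous_map_atin tendsto_mult)
  show ?thesis
  proof (intro complex_normed_space.intro complex_normed_space_axioms.intro moduleI)
    show "cring complex_ring"
      by (intro cringI abelian_groupI comm_monoidI)
        (auto simp: complex_ring_def algebra_simps intro: exI[of _ "- _"])
    show "abelian_group (C_space K)"
    proof (rule abelian_groupI)
      fix f assume "f \<in> carrier (C_space K)"
      then show "\<exists>g\<in>carrier (C_space K). g \<oplus>\<^bsub>C_space K\<^esub> f = \<zero>\<^bsub>C_space K\<^esub>"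
        by (intro bexI[of _ "\<lambda>x\<in>topspace K. - f x"])
          (auto simp: C_space_def intro: continuous_map_minus)
    qed (auto simp: C_space_def extensional_def algebra_simps fun_eq_iff intro: continuous_map_add)
    fix f assume f: "f \<in> carrier (C_space K)"
    then have cf: "continuous_map K euclidean f"
      by (simp add: C_space_def)
    show "vnorm (C_space K) f = 0 \<longleftrightarrow> f = \<zero>\<^bsub>C_space K\<^esub>"
    proof
      assume "vnorm (C_space K) f = 0"
      then have "f x = 0" if "x \<in> topspace K" for x
        using le[OF cf that] by (simp add: C_space_def)
      then show "f = \<zero>\<^bsub>C_space K\<^esub>"
        using f by (auto simp: C_space_def extensional_def fun_eq_iff)
    next
      assume "f = \<zero>\<^bsub>C_space K\<^esub>"
      then show "vnorm (C_space K) f = 0"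
        using least[of f 0] ge0[OF cf] by (simp add: C_space_def)
    qed
    show "vnorm (C_space K) (c \<odot>\<^bsub>C_space K\<^esub> f) = cmod c * vnorm (C_space K) f" for c
    proof (rule antisym)
      have ccf: "continuous_map K euclidean (\<lambda>x\<in>topspace K. c * f x)"
        using cf by (simp add: cont_mult)
      show "vnorm (C_space K) (c \<odot>\<^bsub>C_space K\<^esub> f) \<le> cmod c * vnorm (C_space K) f"
        using le[OF cf] ge0[OF cf]
        by (auto simp: C_space_def norm_mult intro!: least mult_left_mono)
      show "cmod c * vnorm (C_space K) f \<le> vnorm (C_space K) (c \<odot>\<^bsub>C_space K\<^esub> f)"
      proof (cases "c = 0")
        case True
        then show ?thesis using ge0[OF ccf] by (simp add: C_space_def)
      next
        case False
        have "sup_norm K f \<le> sup_norm K (\<lambda>x\<in>topspace K. c * f x) / cmod c"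
          using le[OF ccf] ge0[OF ccf] False
          by (intro least) (auto simp: norm_mult field_simps)
        then show ?thesis using False by (simp add: C_space_def field_simps)
      qed
    qed
    fix g assume "g \<in> carrier (C_space K)"
    then have cg: "continuous_map K euclidean g"
      by (simp add: C_space_def)
    show "vnorm (C_space K) (f \<oplus>\<^bsub>C_space K\<^esub> g) \<le> vnorm (C_space K) f + vnorm (C_space K) g"
      using le[OF cf] le[OF cg] ge0[OF cf] ge0[OF cg]
      by (auto simp: C_space_def intro!: least order_trans[OF norm_triangle_ineq] add_mono)
  qed (auto simp: C_space_def complex_ring_def extensional_def algebra_simps fun_eq_iff intro: cont_mult)
qed


section \<open>Stable phase retrieval\<close>

definition does_SPR :: "'a topology \<Rightarrow> ('a \<Rightarrow> complex) set \<Rightarrow> bool" where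
  "does_SPR K E \<longleftrightarrow>
     submodule E complex_ring (C_space K) \<and>
     (\<exists>C\<ge>1. \<forall>f\<in>E. \<forall>g\<in>E.
        (INF l\<in>{l. cmod l = 1}. sup_norm K (\<lambda>x. f x - l * g x))
          \<le> C * sup_norm K (\<lambda>x. complex_of_real (cmod (f x) - cmod (g x))))"

definition contains_isometric_SPR_copy :: "'a topology \<Rightarrow> 'v normed_module \<Rightarrow> bool" where
  "contains_isometric_SPR_copy K V \<longleftrightarrow>
     (\<exists>T. linear_isometry V (C_space K) T \<and> does_SPR K (T ` carrier V))"

end

theory Submission
  imports Defs
begin

text \<open>
  Let B be the unit ball of the dual of X. Evaluation embeds X isometrically into the functions on B,
  and the range does SPR with constant 3: if the moduli of x and y differ by at most e on B, a
  functional annihilating y puts x within e of a multiple c y, and a functional norming y gives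
  \<bar>cmod c - 1\<bar> * norm y \<le> 2 e. It remains to map K into B, continuously for the pointwise topology
  and with dense range. Since B is convex and pointwise totally bounded on a dense sequence of X,
  such a map is a limit of maps K \<Rightarrow> B, each obtained from the previous one by
  moving its values at finitely many points of the perfect set onto a finer finite net of B by means
  of Urysohn functions.

  Conversely, an isometric copy of the Euclidean plane forces some cmod (f k) to take all values in
  [0, 1], and a minimal closed set on which it still does so is perfect.
\<close>

section \<open>The Hahn--Banach theorem\<close>

text \<open>The constant 3 is e + 2 e: the first summand is the distance from x to c y, the second
  the cost of replacing c by its phase. Dense range suffices because an isometry test involves one
  coordinate of a functional and a comparison of moduli two, so finitely many coordinates have to be
  approximated at a time.

  The space K may fail to be metrizable, and all that the perfect set offers is a supply of
  non-isolated points. Every modification is therefore made on all of K by a Urysohn function, so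
  that nothing has to be extended from the perfect set, and convexity of B keeps the interpolated
  values in B. A value may be moved onto a target only where the old map is already near that
  target; hence the nets are refined by stages, and the density reached at one stage is what permits
  small moves at the next. The points used are kept distinct because none of them is isolated.

  The Euclidean plane serves the converse because each of its unit vectors is normed, up to a phase,
  by one functional only: a point of K at which the image of (t, s) has modulus 1 must reveal
  t.\<close>

locale complex_vector_space = module complex_ring V
  for V (structure)
begin

lemma smult_in_carrier [simp, intro]: "x \<in> carrier V \<Longrightarrow> c \<odot> x \<in> carrier V"
  by (rule smult_closed) (simp_all add: complex_ring_def)

lemma smult_add_left: "x \<in> carrier V \<Longrightarrow> (a + b) \<odot> x = a \<odot> x \<oplus> b \<odot> x"
  using smult_l_distr[of a b x] by (simp add: complex_ring_def)

lemma smult_add_right: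
  "x \<in> carrier V \<Longrightarrow> y \<in> carrier V \<Longrightarrow> c \<odot> (x \<oplus> y) = c \<odot> x \<oplus> c \<odot> y"
  using smult_r_distr[of c x y] by (simp add: complex_ring_def)

lemma smult_smult: "x \<in> carrier V \<Longrightarrow> a \<odot> (b \<odot> x) = (a * b) \<odot> x"
  using smult_assoc1[of a b x] by (simp add: complex_ring_def)

lemma one_smult [simp]: "x \<in> carrier V \<Longrightarrow> 1 \<odot> x = x"
  using smult_one[of x] by (simp add: complex_ring_def)

lemma zero_smult [simp]: "x \<in> carrier V \<Longrightarrow> 0 \<odot> x = \<zero>"
  using smult_l_null[of x] by (simp add: complex_ring_def)

lemma smult_zero [simp]: "c \<odot> \<zero> = \<zero>"
  using smult_r_null[of c] by (simp add: complex_ring_def)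

lemma add_smult_uminus [simp]: "x \<in> carrier V \<Longrightarrow> x \<oplus> (-1) \<odot> x = \<zero>"
  using smult_add_left[of x 1 "-1"] by simp

lemma uminus_eq_smult: "x \<in> carrier V \<Longrightarrow> \<ominus> x = (-1) \<odot> x"
  using M.minus_equality[of "(-1) \<odot> x" x] M.a_comm[of x "(-1) \<odot> x"] by simp

lemma minus_eq_smult: "x \<in> carrier V \<Longrightarrow> y \<in> carrier V \<Longrightarrow> x \<ominus> y = x \<oplus> (-1) \<odot> y"
  by (simp add: M.minus_eq uminus_eq_smult)

section \<open>Sublinear functionals and minimality\<close>

definition sublinear :: "('a \<Rightarrow> real) \<Rightarrow> bool" where
  "sublinear q \<longleftrightarrow>
     (\<forall>x\<in>carrier V. \<forall>y\<in>carrier V. q (x \<oplus> y) \<le> q x + q y) \<and>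
     (\<forall>x\<in>carrier V. \<forall>t\<ge>0. q (complex_of_real t \<odot> x) = t * q x)"

definition seminorm :: "('a \<Rightarrow> real) \<Rightarrow> bool" where
  "seminorm p \<longleftrightarrow>
     (\<forall>x\<in>carrier V. \<forall>y\<in>carrier V. p (x \<oplus> y) \<le> p x + p y) \<and>
     (\<forall>x\<in>carrier V. \<forall>c. p (c \<odot> x) = cmod c * p x)"

lemma seminorm_sublinear: "seminorm p \<Longrightarrow> sublinear p"
  by (auto simp: seminorm_def sublinear_def)

text \<open>One inequality suffices for homogeneity, since applying it with factor 1 / t to the
  vector t x gives the other.\<close>

lemma sublinearI:
  assumes add: "\<And>x y. x \<in> carrier V \<Longrightarrow> y \<in> carrier V \<Longrightarrow> q (x \<oplus> y) \<le> q x + q y"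
    and zero: "q \<zero> = 0"
    and scale: "\<And>x t. x \<in> carrier V \<Longrightarrow> t > 0 \<Longrightarrow> q (complex_of_real t \<odot> x) \<le> t * q x"
  shows "sublinear q"
  unfolding sublinear_def
proof (intro conjI ballI allI impI)
  fix x and t :: real assume x: "x \<in> carrier V" and "t \<ge> 0"
  show "q (complex_of_real t \<odot> x) = t * q x"
  proof (cases "t = 0")
    case False
    with \<open>t \<ge> 0\<close> have t: "t > 0" by simp
    have "q x = q (complex_of_real (1 / t) \<odot> (complex_of_real t \<odot> x))"
      using t x by (simp add: smult_smult)
    also have "\<dots> \<le> (1 / t) * q (complex_of_real t \<odot> x)"
      using t x by (intro scale) auto
    finally have "t * q x \<le> q (complex_of_real t \<odot> x)"
      using t by (simp add: field_simps)
    then show ?thesis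
      using scale[OF x t] by simp
  qed (use x zero in simp)
qed (use add in auto)

lemma sublinear_add: "sublinear q \<Longrightarrow> x \<in> carrier V \<Longrightarrow> y \<in> carrier V \<Longrightarrow> q (x \<oplus> y) \<le> q x + q y"
  by (simp add: sublinear_def)

lemma sublinear_scale: "sublinear q \<Longrightarrow> x \<in> carrier V \<Longrightarrow> t \<ge> 0 \<Longrightarrow> q (complex_of_real t \<odot> x) = t * q x"
  by (simp add: sublinear_def)

lemma sublinear_zero: "sublinear q \<Longrightarrow> q \<zero> = 0"
  using sublinear_scale[of q \<zero> 0] by simp

lemma sublinear_uminus_le:
  assumes "sublinear q" "x \<in> carrier V"
  shows "- q ((-1) \<odot> x) \<le> q x"
  using sublinear_add[OF assms, of "(-1) \<odot> x"] assms by (simp add: sublinear_zero)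

text \<open>Oddness turns subadditivity for \<open>x \<oplus> y\<close> and -y into the reverse
  inequality, and extends homogeneity to negative reals.\<close>

lemma sublinear_odd_linear:
  assumes q: "sublinear q" and odd: "\<And>x. x \<in> carrier V \<Longrightarrow> q ((-1) \<odot> x) \<le> - q x"
  shows "x \<in> carrier V \<Longrightarrow> y \<in> carrier V \<Longrightarrow> q (x \<oplus> y) = q x + q y"
    and "x \<in> carrier V \<Longrightarrow> q (complex_of_real t \<odot> x) = t * q x"
proof -
  have neg: "q ((-1) \<odot> x) = - q x" if "x \<in> carrier V" for x
    using odd[OF that] sublinear_uminus_le[OF q, of "(-1) \<odot> x"] that
    by (simp add: smult_smult)
  show "q (x \<oplus> y) = q x + q y" if x: "x \<in> carrier V" and y: "y \<in> carrier V" for x y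
  proof -
    have "q x = q ((x \<oplus> y) \<oplus> (-1) \<odot> y)"
      using x y by (simp add: M.a_assoc)
    also have "\<dots> \<le> q (x \<oplus> y) + q ((-1) \<odot> y)"
      using x y by (intro sublinear_add[OF q]) auto
    finally show ?thesis
      using sublinear_add[OF q x y] neg[OF y] by simp
  qed
  show "q (complex_of_real t \<odot> x) = t * q x" if x: "x \<in> carrier V" for x t
  proof (cases "t \<ge> 0")
    case False
    have "q (complex_of_real t \<odot> x) = q (complex_of_real (- t) \<odot> ((-1) \<odot> x))"
      using x by (simp add: smult_smult)
    also have "\<dots> = (- t) * q ((-1) \<odot> x)"
      using x False by (intro sublinear_scale[OF q]) auto
    finally show ?thesis
      using neg[OF x] by simp
  qed (use sublinear_scale[OF q x] in simp)
qed

text \<open>A minimal sublinear functional is linear: shift q a lies below q and is at most - q a at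
  - a, so minimality of q forces it to be odd.\<close>

definition shift :: "('a \<Rightarrow> real) \<Rightarrow> 'a \<Rightarrow> 'a \<Rightarrow> real" where
  "shift q a x = (INF t\<in>{0..}. q (x \<oplus> complex_of_real t \<odot> a) - t * q a)"

context
  fixes q a
  assumes q: "sublinear q" and a: "a \<in> carrier V"
begin

text \<open>A lower bound independent of t, from t a = (x + t a) - x; it makes the infimum in
  \<open>shift\<close> meaningful.\<close>

lemma shift_bound:
  assumes "x \<in> carrier V" "t \<ge> 0"
  shows "- q ((-1) \<odot> x) \<le> q (x \<oplus> complex_of_real t \<odot> a) - t * q a"
proof -
  have "(x \<oplus> complex_of_real t \<odot> a) \<oplus> (-1) \<odot> x
      = complex_of_real t \<odot> a \<oplus> (x \<oplus> (-1) \<odot> x)"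
    using assms a by (simp add: M.a_ac del: add_smult_uminus)
  then have "complex_of_real t \<odot> a = (x \<oplus> complex_of_real t \<odot> a) \<oplus> (-1) \<odot> x"
    using assms a by simp
  then have "t * q a = q ((x \<oplus> complex_of_real t \<odot> a) \<oplus> (-1) \<odot> x)"
    using sublinear_scale[OF q a assms(2)] by simp
  also have "\<dots> \<le> q (x \<oplus> complex_of_real t \<odot> a) + q ((-1) \<odot> x)"
    using assms a by (intro sublinear_add[OF q]) auto
  finally show ?thesis by simp
qed

lemma shift_le:
  assumes "x \<in> carrier V" "t \<ge> 0"
  shows "shift q a x \<le> q (x \<oplus> complex_of_real t \<odot> a) - t * q a"
  unfolding shift_def
  by (rule cINF_lower) (use assms shift_bound[OF assms(1)] in \<open>auto intro!: bdd_belowI2\<close>)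

lemma shift_greatest:
  assumes "\<And>t. t \<ge> 0 \<Longrightarrow> m \<le> q (x \<oplus> complex_of_real t \<odot> a) - t * q a"
  shows "m \<le> shift q a x"
  unfolding shift_def by (rule cINF_greatest) (use assms in auto)

lemma shift_le_self: "x \<in> carrier V \<Longrightarrow> shift q a x \<le> q x"
  using shift_le[of x 0] a by simp

lemma shift_uminus: "shift q a ((-1) \<odot> a) \<le> - q a"
proof -
  have "(-1) \<odot> a \<oplus> a = \<zero>"
    using a add_smult_uminus[OF a] M.a_comm[of a "(-1) \<odot> a"] by simp
  then show ?thesis
    using shift_le[of "(-1) \<odot> a" 1] a by (simp add: sublinear_zero[OF q])
qed

lemma sublinear_shift: "sublinear (shift q a)"
proof (rule sublinearI)
  fix x y assume x: "x \<in> carrier V" and y: "y \<in> carrier V"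
  have *: "shift q a (x \<oplus> y) \<le>
      (q (x \<oplus> complex_of_real t \<odot> a) - t * q a) + (q (y \<oplus> complex_of_real s \<odot> a) - s * q a)"
    if "t \<ge> 0" "s \<ge> 0" for t s
  proof -
    have "(x \<oplus> y) \<oplus> complex_of_real (t + s) \<odot> a
        = (x \<oplus> complex_of_real t \<odot> a) \<oplus> (y \<oplus> complex_of_real s \<odot> a)"
      using x y a by (simp add: smult_add_left M.a_ac)
    then have "q ((x \<oplus> y) \<oplus> complex_of_real (t + s) \<odot> a)
        \<le> q (x \<oplus> complex_of_real t \<odot> a) + q (y \<oplus> complex_of_real s \<odot> a)"
      using x y a sublinear_add[OF q] by simp
    then show ?thesis
      using shift_le[of "x \<oplus> y" "t + s"] x y that by (simp add: algebra_simps)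
  qed
  \<comment> \<open>The double infimum is taken one variable at a time: for fixed s over t, then
    over s.\<close>
  have "shift q a (x \<oplus> y) - shift q a x \<le> shift q a y"
  proof (rule shift_greatest)
    fix s :: real assume s: "s \<ge> 0"
    have "shift q a (x \<oplus> y) - (q (y \<oplus> complex_of_real s \<odot> a) - s * q a) \<le> shift q a x"
      by (rule shift_greatest) (use *[OF _ s] in \<open>simp add: algebra_simps\<close>)
    then show "shift q a (x \<oplus> y) - shift q a x \<le> q (y \<oplus> complex_of_real s \<odot> a) - s * q a"
      by simp
  qed
  then show "shift q a (x \<oplus> y) \<le> shift q a x + shift q a y" by simp
next
  show "shift q a \<zero> = 0"
  proof (rule antisym)
    show "shift q a \<zero> \<le> 0"
      using shift_le_self[of \<zero>] sublinear_zero[OF q] by simp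
    show "0 \<le> shift q a \<zero>"
      by (rule shift_greatest) (use a sublinear_scale[OF q a] in simp)
  qed
next
  fix x and r :: real assume x: "x \<in> carrier V" and r: "r > 0"
  have "shift q a (complex_of_real r \<odot> x) / r \<le> shift q a x"
  proof (rule shift_greatest)
    fix t :: real assume t: "t \<ge> 0"
    \<comment> \<open>The parameter \<open>r * t\<close> at r x corresponds to t at x, so the two
      infima differ by the factor r.\<close>
    have "complex_of_real r \<odot> x \<oplus> complex_of_real (r * t) \<odot> a
        = complex_of_real r \<odot> (x \<oplus> complex_of_real t \<odot> a)"
      using x a by (simp add: smult_add_right smult_smult)
    then have "q (complex_of_real r \<odot> x \<oplus> complex_of_real (r * t) \<odot> a)
        = r * q (x \<oplus> complex_of_real t \<odot> a)"
      using sublinear_scale[OF q, of "x \<oplus> complex_of_real t \<odot> a" r] x a r by simp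
    then have "shift q a (complex_of_real r \<odot> x) \<le> r * (q (x \<oplus> complex_of_real t \<odot> a) - t * q a)"
      using shift_le[of "complex_of_real r \<odot> x" "r * t"] x r t by (simp add: algebra_simps)
    then show "shift q a (complex_of_real r \<odot> x) / r \<le> q (x \<oplus> complex_of_real t \<odot> a) - t * q a"
      using r by (simp add: field_simps)
  qed
  then show "shift q a (complex_of_real r \<odot> x) \<le> r * shift q a x"
    using r by (simp add: field_simps)
qed

end

text \<open>Subadditivity needs the chain: for q and r in \<open>Q\<close>, the smaller one
  evaluated at \<open>x \<oplus> y\<close> is at most q x + r y. The infima are finite because
  members below p lie above - p (- x).\<close>

lemma sublinear_INF_chain:
  assumes "Q \<noteq> {}" and sub: "\<And>q. q \<in> Q \<Longrightarrow> sublinear q"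
    and le: "\<And>q x. q \<in> Q \<Longrightarrow> x \<in> carrier V \<Longrightarrow> q x \<le> p x"
    and chain: "\<And>q r. q \<in> Q \<Longrightarrow> r \<in> Q \<Longrightarrow>
      (\<forall>x\<in>carrier V. q x \<le> r x) \<or> (\<forall>x\<in>carrier V. r x \<le> q x)"
  shows "sublinear (\<lambda>x. INF q\<in>Q. q x)"
    and "q \<in> Q \<Longrightarrow> x \<in> carrier V \<Longrightarrow> (INF q\<in>Q. q x) \<le> q x"
proof -
  have lower: "(INF q\<in>Q. q x) \<le> q x" if "q \<in> Q" "x \<in> carrier V" for q x
  proof (rule cINF_lower[OF _ that(1)])
    show "bdd_below ((\<lambda>q. q x) ` Q)"
    proof (rule bdd_belowI2)
      fix r assume "r \<in> Q"
      then show "- p ((-1) \<odot> x) \<le> r x"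
        using sublinear_uminus_le[OF sub, of r x] le[of r "(-1) \<odot> x"] that by simp
    qed
  qed
  show "q \<in> Q \<Longrightarrow> x \<in> carrier V \<Longrightarrow> (INF q\<in>Q. q x) \<le> q x"
    by (rule lower)
  show "sublinear (\<lambda>x. INF q\<in>Q. q x)"
  proof (rule sublinearI)
    fix x y assume x: "x \<in> carrier V" and y: "y \<in> carrier V"
    have *: "(INF q\<in>Q. q (x \<oplus> y)) \<le> q x + r y" if "q \<in> Q" "r \<in> Q" for q r
      using chain[OF that]
    proof
      assume "\<forall>x\<in>carrier V. q x \<le> r x"
      then show ?thesis
        using lower[OF that(1), of "x \<oplus> y"] sublinear_add[OF sub[OF that(1)] x y] x y by fastforce
    next
      assume "\<forall>x\<in>carrier V. r x \<le> q x"
      then show ?thesis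
        using lower[OF that(2), of "x \<oplus> y"] sublinear_add[OF sub[OF that(2)] x y] x y by fastforce
    qed
    have "(INF q\<in>Q. q (x \<oplus> y)) - (INF q\<in>Q. q x) \<le> (INF r\<in>Q. r y)"
    proof (rule cINF_greatest[OF assms(1)])
      fix r assume r: "r \<in> Q"
      have "(INF q\<in>Q. q (x \<oplus> y)) - r y \<le> (INF q\<in>Q. q x)"
        by (rule cINF_greatest[OF assms(1)]) (use *[OF _ r] in \<open>simp add: algebra_simps\<close>)
      then show "(INF q\<in>Q. q (x \<oplus> y)) - (INF q\<in>Q. q x) \<le> r y" by simp
    qed
    then show "(INF q\<in>Q. q (x \<oplus> y)) \<le> (INF q\<in>Q. q x) + (INF q\<in>Q. q y)" by simp
  next
    show "(INF q\<in>Q. q \<zero>) = 0"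
      using assms(1) sub by (simp add: sublinear_zero cong: INF_cong_simp)
  next
    fix x and t :: real assume x: "x \<in> carrier V" and t: "t > 0"
    have "(INF q\<in>Q. q (complex_of_real t \<odot> x)) / t \<le> (INF q\<in>Q. q x)"
    proof (rule cINF_greatest[OF assms(1)])
      fix q assume "q \<in> Q"
      then show "(INF q\<in>Q. q (complex_of_real t \<odot> x)) / t \<le> q x"
        using lower[of q "complex_of_real t \<odot> x"] sublinear_scale[OF sub, of q x t] x t
        by (simp add: field_simps)
    qed
    then show "(INF q\<in>Q. q (complex_of_real t \<odot> x)) \<le> t * (INF q\<in>Q. q x)"
      using t by (simp add: field_simps)
  qed
qed

text \<open>Zorn's lemma for the reversed order \<open>P\<close>, whose maximal elements are the
  minimal functionals. Passing to functions extensional on the carrier turns equality on the carrier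
  into equality, as antisymmetry requires.\<close>

lemma exists_minimal_sublinear:
  assumes p: "sublinear p"
  shows "\<exists>q. sublinear q \<and> (\<forall>x\<in>carrier V. q x \<le> p x) \<and>
    (\<forall>r. sublinear r \<longrightarrow> (\<forall>x\<in>carrier V. r x \<le> q x) \<longrightarrow> (\<forall>x\<in>carrier V. r x = q x))"
proof -
  define A where "A = {q. sublinear q \<and> (\<forall>x\<in>carrier V. q x \<le> p x) \<and> q \<in> extensional (carrier V)}"
  define P where "P = (\<lambda>q r. \<forall>x\<in>carrier V. r x \<le> (q x :: real))"
  have restr: "sublinear (restrict q (carrier V)) \<longleftrightarrow> sublinear q" for q
    by (simp add: sublinear_def)
  have pA: "restrict p (carrier V) \<in> A"
    using p by (simp add: A_def restr)
  have "\<exists>m\<in>A. \<forall>a\<in>A. P m a \<longrightarrow> a = m"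
  proof (rule predicate_Zorn)
    show "partial_order_on A (relation_of P A)"
    proof (rule partial_order_on_relation_ofI)
      show "P q q" for q by (simp add: P_def)
      show "P q s" if "P q r" "P r s" for q r s
        using that by (force simp: P_def)
      show "q = r" if "q \<in> A" "r \<in> A" "P q r" "P r q" for q r
        using that by (intro extensionalityI[of q "carrier V" r]) (auto simp: A_def P_def intro: antisym)
    qed
    fix Q assume Q: "Q \<in> Chains (relation_of P A)"
    then have QA: "Q \<subseteq> A" by (rule Chains_relation_of)
    show "\<exists>u\<in>A. \<forall>a\<in>Q. P a u"
    proof (cases "Q = {}")
      case False
      have chain: "(\<forall>x\<in>carrier V. q x \<le> r x) \<or> (\<forall>x\<in>carrier V. r x \<le> q x)"
        if "q \<in> Q" "r \<in> Q" for q r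
        using that Q by (auto simp: Chains_def relation_of_def P_def)
      let ?u = "\<lambda>x. INF q\<in>Q. q x"
      have "sublinear ?u" and lower: "\<And>q x. q \<in> Q \<Longrightarrow> x \<in> carrier V \<Longrightarrow> ?u x \<le> q x"
        using sublinear_INF_chain[of Q p] False QA chain unfolding A_def by blast+
      moreover have "\<forall>x\<in>carrier V. ?u x \<le> p x"
      proof
        fix x assume x: "x \<in> carrier V"
        obtain q where "q \<in> Q" using False by blast
        then show "?u x \<le> p x"
          using lower[OF _ x, of q] QA x by (force simp: A_def)
      qed
      ultimately show ?thesis
        by (intro bexI[of _ "restrict ?u (carrier V)"]) (auto simp: A_def P_def restr)
    qed (use pA in auto)
  qed
  then obtain m where m: "m \<in> A" and min: "\<And>a. a \<in> A \<Longrightarrow> P m a \<Longrightarrow> a = m"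
    by blast
  show ?thesis
  proof (intro exI[of _ m] conjI allI impI ballI)
    show "m x \<le> p x" if "x \<in> carrier V" for x
      using m that by (auto simp: A_def)
    show "sublinear m"
      using m by (simp add: A_def)
    fix r x assume r: "sublinear r" "\<forall>x\<in>carrier V. r x \<le> m x" and x: "x \<in> carrier V"
    have "restrict r (carrier V) = m"
      using r m by (intro min) (fastforce simp: A_def P_def restr)+
    then show "r x = m x"
      using x by (metis restrict_apply')
  qed
qed

text \<open>Minimality is sought below \<open>shift p a\<close> instead of p. This forces q (- a) to
  be at most - p a, so that the linear functional q attains p at a without an extension from a
  subspace.\<close>

lemma hahn_banach_real:
  assumes p: "sublinear p" and a: "a \<in> carrier V"
  shows "\<exists>f. (\<forall>x\<in>carrier V. \<forall>y\<in>carrier V. f (x \<oplus> y) = f x + f y) \<and>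
    (\<forall>t. \<forall>x\<in>carrier V. f (complex_of_real t \<odot> x) = t * f x) \<and>
    (\<forall>x\<in>carrier V. f x \<le> p x) \<and> f a = p a"
proof -
  obtain q where q: "sublinear q" "\<forall>x\<in>carrier V. q x \<le> shift p a x"
    and min: "\<forall>r. sublinear r \<longrightarrow> (\<forall>x\<in>carrier V. r x \<le> q x) \<longrightarrow> (\<forall>x\<in>carrier V. r x = q x)"
    using exists_minimal_sublinear[OF sublinear_shift[OF p a]] by (elim exE conjE)
  have odd: "q ((-1) \<odot> x) \<le> - q x" if x: "x \<in> carrier V" for x
  proof -
    have "\<forall>y\<in>carrier V. shift q x y = q y"
      using min sublinear_shift[OF q(1) x] shift_le_self[OF q(1) x] by simp
    then show ?thesis
      using shift_uminus[OF q(1) x] x by simp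
  qed
  note lin = sublinear_odd_linear[OF q(1) odd]
  have le: "q x \<le> p x" if "x \<in> carrier V" for x
    using bspec[OF q(2) that] shift_le_self[OF p a that] by simp
  have "q ((-1) \<odot> a) \<le> - p a"
    using bspec[OF q(2), of "(-1) \<odot> a"] shift_uminus[OF p a] a by simp
  then have "q a = p a"
    using le[OF a] sublinear_uminus_le[OF q(1) a] by simp
  with lin le show ?thesis by blast
qed

section \<open>Complex functionals\<close>

definition functional :: "('a \<Rightarrow> complex) \<Rightarrow> bool" where
  "functional \<phi> \<longleftrightarrow>
     (\<forall>x\<in>carrier V. \<forall>y\<in>carrier V. \<phi> (x \<oplus> y) = \<phi> x + \<phi> y) \<and>
     (\<forall>c. \<forall>x\<in>carrier V. \<phi> (c \<odot> x) = c * \<phi> x)"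

lemma functional_add: "functional \<phi> \<Longrightarrow> x \<in> carrier V \<Longrightarrow> y \<in> carrier V \<Longrightarrow> \<phi> (x \<oplus> y) = \<phi> x + \<phi> y"
  by (simp add: functional_def)

lemma functional_smult: "functional \<phi> \<Longrightarrow> x \<in> carrier V \<Longrightarrow> \<phi> (c \<odot> x) = c * \<phi> x"
  by (simp add: functional_def)

theorem hahn_banach:
  assumes p: "seminorm p" and a: "a \<in> carrier V"
  obtains \<phi> where "functional \<phi>" "\<And>x. x \<in> carrier V \<Longrightarrow> cmod (\<phi> x) \<le> p x" "\<phi> a = p a"
proof -
  obtain f where add: "\<forall>x\<in>carrier V. \<forall>y\<in>carrier V. f (x \<oplus> y) = f x + f y"
    and scale: "\<forall>t. \<forall>x\<in>carrier V. f (complex_of_real t \<odot> x) = t * f x"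
    and le: "\<forall>x\<in>carrier V. f x \<le> p x" and fa: "f a = p a"
    using hahn_banach_real[OF seminorm_sublinear[OF p] a] by (elim exE conjE)
  \<comment> \<open>A complex linear functional is determined by its real part f, and this is the
    formula that recovers it.\<close>
  define \<phi> where "\<phi> = (\<lambda>x. Complex (f x) (- f (\<i> \<odot> x)))"
  have f_smult: "f (c \<odot> x) = Re c * f x + Im c * f (\<i> \<odot> x)" if x: "x \<in> carrier V" for c x
  proof -
    have "c = complex_of_real (Re c) + complex_of_real (Im c) * \<i>"
      by (simp add: complex_eq_iff)
    then have "c \<odot> x = complex_of_real (Re c) \<odot> x \<oplus> complex_of_real (Im c) \<odot> (\<i> \<odot> x)"
      using x by (metis smult_add_left smult_smult)
    then show ?thesis
      using x add scale by simp
  qed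
  have lin: "functional \<phi>"
    unfolding functional_def
  proof (intro conjI ballI allI)
    fix x y assume "x \<in> carrier V" "y \<in> carrier V"
    then show "\<phi> (x \<oplus> y) = \<phi> x + \<phi> y"
      by (simp add: \<phi>_def complex_eq_iff add smult_add_right)
  next
    fix c x assume x: "x \<in> carrier V"
    have "f (\<i> \<odot> (c \<odot> x)) = - Im c * f x + Re c * f (\<i> \<odot> x)"
      using f_smult[OF x, of "\<i> * c"] x by (simp add: smult_smult)
    then show "\<phi> (c \<odot> x) = c * \<phi> x"
      using f_smult[OF x, of c] by (simp add: \<phi>_def complex_eq_iff)
  qed
  moreover have bound: "cmod (\<phi> x) \<le> p x" if x: "x \<in> carrier V" for x
  proof -
    \<comment> \<open>Rotating x by a phase makes the value real and nonnegative, where the bound on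
      f applies.\<close>
    obtain c where c: "cmod c = 1" "c * \<phi> x = cmod (\<phi> x)"
    proof (cases "\<phi> x = 0")
      case False
      then show thesis
        using that[of "cnj (\<phi> x) / cmod (\<phi> x)"] complex_norm_square[of "\<phi> x"]
        by (simp add: norm_divide field_simps power2_eq_square)
    qed (use that[of 1] in simp)
    have "cmod (\<phi> x) = Re (\<phi> (c \<odot> x))"
      using c(2) functional_smult[OF lin x, of c] by (metis Re_complex_of_real)
    also have "\<dots> = f (c \<odot> x)" by (simp add: \<phi>_def)
    also have "\<dots> \<le> p (c \<odot> x)" using x le by simp
    also have "\<dots> = p x" using p x c(1) by (simp add: seminorm_def)
    finally show ?thesis .
  qed
  \<comment> \<open>The real part already has the largest modulus allowed, so the imaginary part
    vanishes.\<close>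
  moreover have "\<phi> a = p a"
  proof -
    have "Re (\<phi> a) = p a" by (simp add: \<phi>_def fa)
    moreover have "(Re (\<phi> a))\<^sup>2 + (Im (\<phi> a))\<^sup>2 \<le> (p a)\<^sup>2"
      using bound[OF a] by (metis cmod_power2 norm_ge_zero power_mono)
    ultimately show ?thesis by (simp add: complex_eq_iff)
  qed
  ultimately show thesis by (rule that)
qed

end

section \<open>Maps of a perfect set into a convex set of functions\<close>

lemma perfect_set_of_interval_image:
  fixes u :: "'a \<Rightarrow> real"
  assumes K: "compact_space K" and u: "continuous_map K euclideanreal u"
    and surj: "{0..1} \<subseteq> u ` topspace K"
  shows "\<exists>P. perfect_set_in K P"
proof -
  \<comment> \<open>Complements of the competing closed sets: a minimal closed set becomes a maximal
    open one, and chains have unions as upper bounds.\<close>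
  define \<A> where "\<A> = {U. openin K U \<and> {0..1} \<subseteq> u ` (topspace K - U)}"
  have "\<exists>M\<in>\<A>. \<forall>X\<in>\<A>. M \<subseteq> X \<longrightarrow> X = M"
  proof (rule subset_Zorn_nonempty)
    show "\<A> \<noteq> {}"
      using surj by (auto simp: \<A>_def intro!: exI[of _ "{}"])
    fix \<C> assume ne: "\<C> \<noteq> {}" and chain: "subset.chain \<A> \<C>"
    then have sub: "\<C> \<subseteq> \<A>" by (simp add: subset.chain_def)
    have "t \<in> u ` (topspace K - \<Union>\<C>)" if t: "t \<in> {0..1}" for t
    proof (rule ccontr)
      assume no: "t \<notin> u ` (topspace K - \<Union>\<C>)"
      \<comment> \<open>If the union of the chain lost the value t, it would cover the compact fibre
        over t. Finitely many members would then cover it, hence the largest of them alone, which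
        contradicts that this member keeps t.\<close>
      let ?S = "{x \<in> topspace K. u x \<in> {t}}"
      have "closedin K ?S"
        by (rule closedin_continuous_map_preimage[OF u]) simp
      then have "compactin K ?S"
        using K closedin_compact_space by blast
      moreover have "?S \<subseteq> \<Union>\<C>" using no by auto
      moreover have "\<forall>U\<in>\<C>. openin K U" using sub by (auto simp: \<A>_def)
      ultimately obtain \<F> where F: "finite \<F>" "\<F> \<subseteq> \<C>" "?S \<subseteq> \<Union>\<F>"
        unfolding compactin_def by meson
      have "?S \<noteq> {}" using surj t by auto
      then have "\<F> \<noteq> {}" using F by auto
      moreover have "subset.chain \<A> \<F>"
        using chain F(2) unfolding subset.chain_def by (meson subset_trans subsetD)
      ultimately have "\<Union>\<F> \<in> \<F>"
        using F(1) Union_in_chain by blast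
      then have "{0..1} \<subseteq> u ` (topspace K - \<Union>\<F>)"
        using F(2) sub by (auto simp: \<A>_def)
      then show False using F(3) t by blast
    qed
    then show "\<Union>\<C> \<in> \<A>"
      using sub by (auto simp: \<A>_def)
  qed
  then obtain M where "M \<in> \<A>" and max: "\<forall>X\<in>\<A>. M \<subseteq> X \<longrightarrow> X = M"
    by (elim bexE)
  then have M: "openin K M" "{0..1} \<subseteq> u ` (topspace K - M)"
    by (simp_all add: \<A>_def)
  define P where "P = topspace K - M"
  have "perfect_set_in K P"
    unfolding perfect_set_in_def
  proof (intro conjI ballI notI)
    show P: "closedin K P" using M(1) by (auto simp: P_def)
    show False if "P = {}"
      using that M(2) by (force simp: P_def)
    fix x assume x: "x \<in> P" and iso: "openin (subtopology K P) {x}"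
    have "closedin (subtopology K P) (P - {x})"
      using closedin_diff[OF closedin_topspace iso] topspace_subtopology_subset[OF closedin_subset[OF P]]
      by simp
    then have cl: "closedin K (P - {x})"
      using P closedin_trans_full by blast
    then have "compactin euclideanreal (u ` (P - {x}))"
      using K u closedin_compact_space image_compactin by blast
    then have closed: "closed (u ` (P - {x}))"
      by (simp add: compact_imp_closed)
    \<comment> \<open>Deleting the isolated point costs at most the value u x. The image of what
      remains is closed, and the interval without one point is dense in the interval, so no value is
      lost and minimality fails.\<close>
    have "{0..1} - {u x} \<subseteq> u ` (P - {x})"
      using M(2) by (auto simp: P_def)
    then have "closure ({0..1} - {u x}) \<subseteq> u ` (P - {x})"
      using closed closure_minimal by blast
    moreover have "{0..1} \<subseteq> closure ({0..1::real} - {u x})"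
    proof
      fix t :: real assume t: "t \<in> {0..1}"
      have "t islimpt {0..1}"
        using t by (intro connected_imp_perfect[of "{0..1}"]) (auto intro: exI[of _ 0] exI[of _ 1])
      then have "t islimpt ({0..1} - {u x})"
        using islimpt_insert[of t "u x" "{0..1} - {u x}"] islimpt_subset[of t "{0..1}" "insert (u x) {0..1}"]
        by auto
      then show "t \<in> closure ({0..1} - {u x})"
        by (simp add: closure_def)
    qed
    ultimately have "{0..1} \<subseteq> u ` (topspace K - (M \<union> {x} \<inter> topspace K))"
      by (auto simp: P_def)
    moreover have "topspace K - (P - {x}) = M \<union> {x}"
      using x openin_subset[OF M(1)] by (auto simp: P_def)
    then have "openin K (M \<union> {x})"
      using openin_diff[OF openin_topspace cl] by simp
    moreover have "{x} \<inter> topspace K = {x}"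
      using x by (auto simp: P_def)
    ultimately have "M \<union> {x} \<in> \<A>"
      by (simp add: \<A>_def)
    then have "M \<union> {x} = M"
      using max by blast
    then show False using x by (auto simp: P_def)
  qed
  then show ?thesis by blast
qed

section \<open>Approximation of a convex set of functions in finitely many coordinates\<close>

lemma finite_net:
  fixes B :: "('i \<Rightarrow> complex) set"
  assumes bdd: "\<And>\<phi> j. \<phi> \<in> B \<Longrightarrow> cmod (\<phi> (x j)) \<le> M j" and r: "r > 0"
  shows "\<exists>F. finite F \<and> F \<subseteq> B \<and> (\<forall>\<psi>\<in>B. \<exists>\<nu>\<in>F. \<forall>j<n::nat. cmod (\<nu> (x j) - \<psi> (x j)) < r)"
proof -
  have "\<exists>C. finite C \<and> cball (0 :: complex) (M j) \<subseteq> (\<Union>c\<in>C. ball c (r / 2))" for j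
  proof -
    have "\<forall>e>0. \<exists>C. finite C \<and> cball (0 :: complex) (M j) \<subseteq> (\<Union>c\<in>C. ball c e)"
      using compact_cball[of "0 :: complex" "M j"] unfolding compact_eq_totally_bounded ..
    from this[rule_format, of "r / 2"] r show ?thesis by simp
  qed
  then obtain C where C: "\<And>j. finite (C j)" "\<And>j. cball (0 :: complex) (M j) \<subseteq> (\<Union>c\<in>C j. ball c (r / 2))"
    by metis
  \<comment> \<open>The code rounds the first n coordinates to centres of finite r / 2 nets.
    Functions with equal codes are within r of each other.\<close>
  define code where "code \<psi> = (\<lambda>j\<in>{..<n}. SOME c. c \<in> C j \<and> dist c (\<psi> (x j)) < r / 2)" for \<psi>
  have code: "code \<psi> j \<in> C j \<and> dist (code \<psi> j) (\<psi> (x j)) < r / 2" if "\<psi> \<in> B" "j < n" for \<psi> j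
  proof -
    have "\<psi> (x j) \<in> cball 0 (M j)" using bdd[OF that(1)] by simp
    then have "\<psi> (x j) \<in> (\<Union>c\<in>C j. ball c (r / 2))" using C(2)[of j] by blast
    then have "\<exists>c. c \<in> C j \<and> dist c (\<psi> (x j)) < r / 2" by auto
    from someI_ex[OF this] show ?thesis using that(2) by (simp add: code_def)
  qed
  have "code ` B \<subseteq> PiE {..<n} C"
    using code by (auto simp: PiE_def) (simp add: code_def)
  then have "finite (code ` B)"
    by (rule finite_subset) (use C(1) in \<open>auto intro: finite_PiE\<close>)
  \<comment> \<open>One representative for each code that occurs; this puts the net inside
    \<open>B\<close>, whereas the centres themselves need not come from members of
    \<open>B\<close>.\<close>
  then obtain F where F: "F \<subseteq> B" "finite F" "code ` B = code ` F"
    using finite_subset_image[of "code ` B" code B] by auto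
  show ?thesis
  proof (intro exI[of _ F] conjI F ballI)
    fix \<psi> assume \<psi>: "\<psi> \<in> B"
    then obtain \<nu> where \<nu>: "\<nu> \<in> F" "code \<psi> = code \<nu>" using F(3) by blast
    have "cmod (\<nu> (x j) - \<psi> (x j)) < r" if j: "j < n" for j
    proof -
      have "\<nu> \<in> B" using \<nu>(1) F(1) by blast
      from code[OF this j] code[OF \<psi> j] \<nu>(2) show ?thesis
        using dist_triangle_half_r[of "code \<psi> j" "\<nu> (x j)" r "\<psi> (x j)"] by (simp add: dist_norm)
    qed
    with \<nu> show "\<exists>\<nu>\<in>F. \<forall>j<n. cmod (\<nu> (x j) - \<psi> (x j)) < r" by blast
  qed
qed

text \<open>For maps into the dual unit ball, with \<open>I\<close> the carrier, this is weak-*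
  continuity.\<close>

definition coordinatewise_continuous :: "'a topology \<Rightarrow> 'i set \<Rightarrow> ('a \<Rightarrow> 'i \<Rightarrow> complex) \<Rightarrow> bool" where
  "coordinatewise_continuous K I h \<longleftrightarrow> (\<forall>i\<in>I. continuous_map K euclidean (\<lambda>k. h k i))"

locale perfect_convex =
  fixes K :: "'a topology" and P :: "'a set" and B :: "('i \<Rightarrow> complex) set"
  assumes compact: "compact_space K" and Hausdorff: "Hausdorff_space K"
    and perfect: "perfect_set_in K P"
    and convex: "\<And>\<phi> \<psi> t. \<phi> \<in> B \<Longrightarrow> \<psi> \<in> B \<Longrightarrow> 0 \<le> t \<Longrightarrow> t \<le> 1 \<Longrightarrow>
      (\<lambda>i. complex_of_real (1 - t) * \<phi> i + complex_of_real t * \<psi> i) \<in> B"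
begin

lemma P_subset: "P \<subseteq> topspace K"
  using perfect closedin_subset by (auto simp: perfect_set_in_def)

text \<open>Deleting from \<open>W\<close> the finitely many points of \<open>Q\<close> other than p
  leaves a neighbourhood of p, because finite sets are closed in a Hausdorff space. Its trace on the
  perfect set contains a point besides p, and that point avoids all of \<open>Q\<close>.\<close>

lemma perfect_avoids_finite:
  assumes W: "openin K W" "p \<in> W" "p \<in> P" and Q: "finite Q"
  obtains q where "q \<in> W" "q \<in> P" "q \<notin> Q"
proof -
  have "openin K (W - (Q - {p}) \<inter> topspace K)"
    using W Q Hausdorff
    by (intro openin_diff) (auto intro: closedin_Hausdorff_finite)
  then have "openin (subtopology K P) (P \<inter> (W - (Q - {p}) \<inter> topspace K))"
    by (simp add: openin_subtopology_Int2)
  moreover have "\<not> openin (subtopology K P) {p}"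
    using perfect W(3) by (auto simp: perfect_set_in_def)
  ultimately have "P \<inter> (W - (Q - {p}) \<inter> topspace K) \<noteq> {p}" by metis
  then obtain q where "q \<noteq> p" "q \<in> P" "q \<in> W" "q \<notin> (Q - {p}) \<inter> topspace K"
    using W by blast
  then show thesis
    using that P_subset by blast
qed

text \<open>The targets are inserted one at a time. The bumps may overlap, but the coordinate ball of
  radius r around h k is convex, so the deviations do not accumulate.\<close>

lemma attain_targets:
  assumes hB: "\<And>k. k \<in> topspace K \<Longrightarrow> h k \<in> B" and cont: "coordinatewise_continuous K UNIV h"
    and r: "r > 0" and J: "finite J"
    and F: "finite F" "F \<subseteq> B" "\<And>\<nu>. \<nu> \<in> F \<Longrightarrow> \<exists>p\<in>P. \<forall>i\<in>J. cmod (h p i - \<nu> i) < r"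
  shows "\<exists>h'. (\<forall>k\<in>topspace K. h' k \<in> B) \<and> coordinatewise_continuous K UNIV h' \<and>
    (\<forall>k\<in>topspace K. \<forall>i\<in>J. cmod (h' k i - h k i) \<le> r) \<and> (\<forall>\<nu>\<in>F. \<exists>q\<in>P. h' q = \<nu>)"
proof -
  \<comment> \<open>The induction also records the finite set \<open>Q\<close> of points already in
    use, so that later modifications can leave the values there untouched.\<close>
  have "\<exists>h' Q. (\<forall>k\<in>topspace K. h' k \<in> B) \<and> coordinatewise_continuous K UNIV h' \<and>
      (\<forall>k\<in>topspace K. \<forall>i\<in>J. cmod (h' k i - h k i) \<le> r) \<and>
      finite Q \<and> Q \<subseteq> P \<and> (\<forall>\<nu>\<in>F. \<exists>q\<in>Q. h' q = \<nu>)"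
    using F
  proof (induction F rule: finite_induct)
    case empty
    show ?case
      by (intro exI[of _ h] exI[of _ "{}"]) (use hB cont r in auto)
  next
    case (insert \<nu> F)
    have "F \<subseteq> B" "\<And>\<nu>. \<nu> \<in> F \<Longrightarrow> \<exists>p\<in>P. \<forall>i\<in>J. cmod (h p i - \<nu> i) < r"
      using insert.prems by auto
    from insert.IH[OF this, simplified] obtain h' Q where h'B: "\<forall>k\<in>topspace K. h' k \<in> B"
      and h'cont: "coordinatewise_continuous K UNIV h'"
      and close: "\<forall>k\<in>topspace K. \<forall>i\<in>J. cmod (h' k i - h k i) \<le> r"
      and Q: "finite Q" "Q \<subseteq> P" and att: "\<forall>\<nu>\<in>F. \<exists>q\<in>Q. h' q = \<nu>"
      by (elim exE conjE)
    obtain p where p: "p \<in> P" "\<forall>i\<in>J. cmod (h p i - \<nu> i) < r"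
      using insert.prems by blast
    \<comment> \<open>Nearness is measured from the original h and not from the current map: on
      \<open>W\<close> both the current value and the target lie in the same coordinate ball around
      h k.\<close>
    define W where "W = {k \<in> topspace K. \<forall>i\<in>J. cmod (h k i - \<nu> i) < r}"
    have "openin K {k \<in> topspace K. h k i \<in> ball (\<nu> i) r}" for i
      using cont by (intro openin_continuous_map_preimage[of K euclidean "\<lambda>k. h k i"])
        (auto simp: coordinatewise_continuous_def)
    moreover have "W = topspace K \<inter> (\<Inter>i\<in>J. {k \<in> topspace K. h k i \<in> ball (\<nu> i) r})"
      by (auto simp: W_def dist_norm norm_minus_commute)
    ultimately have W: "openin K W"
      using J by (cases "J = {}") (auto intro!: openin_Int openin_INT2)
    have "p \<in> W" using p P_subset by (auto simp: W_def)
    then obtain q where q: "q \<in> W" "q \<in> P" "q \<notin> Q"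
      using perfect_avoids_finite[OF W _ p(1) Q(1)] by blast
    have Z: "closedin K (Q \<union> (topspace K - W))"
      using Q P_subset W Hausdorff by (intro closedin_Un closedin_Hausdorff_finite[of K Q]) auto
    have q1: "closedin K {q}"
      using q P_subset Hausdorff by (intro closedin_Hausdorff_finite) auto
    \<comment> \<open>The bump is 1 at the fresh point q, where the target is attained. It vanishes
      on \<open>Q\<close>, which protects earlier targets, and off \<open>W\<close>, where the
      target may be far from h.\<close>
    have "disjnt (Q \<union> (topspace K - W)) {q}" using q by auto
    then obtain b where b: "continuous_map K (top_of_set {0..1::real}) b"
      and b0: "b ` (Q \<union> (topspace K - W)) \<subseteq> {0}" and b1: "b ` {q} \<subseteq> {1}"
      using Urysohn_lemma[OF compact_Hausdorff_or_regular_imp_normal_space Z q1, of 0 1]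
        compact Hausdorff by auto
    have bc: "continuous_map K euclideanreal b" and b01: "\<And>k. k \<in> topspace K \<Longrightarrow> 0 \<le> b k \<and> b k \<le> 1"
      using b by (auto simp: continuous_map_in_subtopology)
    define g where "g k = (\<lambda>i. complex_of_real (1 - b k) * h' k i + complex_of_real (b k) * \<nu> i)" for k
    show ?case
    proof (intro exI[of _ g] exI[of _ "insert q Q"] conjI ballI)
      show "g k \<in> B" if "k \<in> topspace K" for k
        unfolding g_def using that h'B b01 insert.prems by (intro convex) auto
      show "coordinatewise_continuous K UNIV g"
        using h'cont bc unfolding coordinatewise_continuous_def g_def
        by (auto simp: continuous_map_atin intro!: tendsto_intros)
      show "cmod (g k i - h k i) \<le> r" if k: "k \<in> topspace K" and i: "i \<in> J" for k i
      proof (cases "k \<in> W")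
        case True
        have "g k i - h k i = complex_of_real (1 - b k) * (h' k i - h k i)
            + complex_of_real (b k) * (\<nu> i - h k i)"
          by (simp add: g_def algebra_simps)
        then have "cmod (g k i - h k i) \<le> (1 - b k) * cmod (h' k i - h k i) + b k * cmod (\<nu> i - h k i)"
          using b01[OF k] norm_triangle_ineq[of "complex_of_real (1 - b k) * (h' k i - h k i)"
              "complex_of_real (b k) * (\<nu> i - h k i)"]
          by (simp add: norm_mult del: of_real_diff)
        also have "\<dots> \<le> (1 - b k) * r + b k * r"
          using b01[OF k] close k True i
          by (intro add_mono mult_left_mono) (auto simp: W_def norm_minus_commute less_imp_le)
        finally show ?thesis by (simp add: algebra_simps)
      next
        case False
        then have "b k = 0" using b0 k by blast
        then show ?thesis using close k i by (simp add: g_def)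
      qed
      show "\<exists>a\<in>insert q Q. g a = \<mu>" if "\<mu> \<in> insert \<nu> F" for \<mu>
      proof (cases "\<mu> = \<nu>")
        case True
        have "b q = 1" using b1 by simp
        then show ?thesis using True by (auto simp: g_def)
      next
        case False
        then obtain a where a: "a \<in> Q" "h' a = \<mu>" using att \<open>\<mu> \<in> insert \<nu> F\<close> by blast
        then have "b a = 0" using b0 by blast
        then have "g a = \<mu>" using a by (simp add: g_def)
        then show ?thesis using a by blast
      qed
    qed (use Q q in auto)
  qed
  then obtain h' Q where h': "\<forall>k\<in>topspace K. h' k \<in> B" "coordinatewise_continuous K UNIV h'"
    "\<forall>k\<in>topspace K. \<forall>i\<in>J. cmod (h' k i - h k i) \<le> r" and Q: "Q \<subseteq> P" "\<forall>\<nu>\<in>F. \<exists>q\<in>Q. h' q = \<nu>"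
    by (elim exE conjE)
  from Q have "\<forall>\<nu>\<in>F. \<exists>q\<in>P. h' q = \<nu>" by blast
  with h' show ?thesis by (intro exI[of _ h'] conjI)
qed

text \<open>Density of the n-th map in the coordinates below n is exactly what permits moving its
  values onto the next net by at most (1 / 2) ^ n in these coordinates. The coordinate n enters the
  next net without any control on its first move.\<close>

lemma refining_sequence:
  fixes x :: "nat \<Rightarrow> 'i"
  assumes ne: "B \<noteq> {}" and bdd: "\<And>\<phi> j. \<phi> \<in> B \<Longrightarrow> cmod (\<phi> (x j)) \<le> M j"
  shows "\<exists>h. \<forall>n. ((\<forall>k\<in>topspace K. h n k \<in> B) \<and> coordinatewise_continuous K UNIV (h n) \<and>
      (\<forall>\<psi>\<in>B. \<exists>p\<in>P. \<forall>j<n. cmod (h n p (x j) - \<psi> (x j)) < (1 / 2) ^ n)) \<and>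
    (\<forall>k\<in>topspace K. \<forall>j<n. cmod (h (Suc n) k (x j) - h n k (x j)) \<le> (1 / 2) ^ n)"
    (is "\<exists>h. \<forall>n. ?R n (h n) \<and> ?S n (h n) (h (Suc n))")
proof (rule dependent_nat_choice)
  \<comment> \<open>At stage 0 no coordinate is tested, so a constant map will do.\<close>
  obtain \<phi> where "\<phi> \<in> B" using ne by blast
  then show "\<exists>h. ?R 0 h"
    using perfect by (intro exI[of _ "\<lambda>_. \<phi>"])
      (auto simp: coordinatewise_continuous_def perfect_set_in_def)
next
  fix h n assume h: "?R n h"
  have "\<exists>F. finite F \<and> F \<subseteq> B \<and>
      (\<forall>\<psi>\<in>B. \<exists>\<nu>\<in>F. \<forall>j<Suc n. cmod (\<nu> (x j) - \<psi> (x j)) < (1 / 2) ^ Suc n)"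
    by (rule finite_net[of B x M]) (use bdd in simp_all)
  then obtain F where F: "finite F" "F \<subseteq> B"
    "\<forall>\<psi>\<in>B. \<exists>\<nu>\<in>F. \<forall>j<Suc n. cmod (\<nu> (x j) - \<psi> (x j)) < (1 / 2) ^ Suc n"
    by (elim exE conjE)
  have near: "\<exists>p\<in>P. \<forall>i\<in>x ` {..<n}. cmod (h p i - \<nu> i) < (1 / 2) ^ n" if \<nu>: "\<nu> \<in> F" for \<nu>
  proof -
    have "\<nu> \<in> B" using \<nu> F(2) by (rule subsetD[rotated])
    obtain p where "p \<in> P" "\<forall>j<n. cmod (h p (x j) - \<nu> (x j)) < (1 / 2) ^ n"
      using bspec[OF conjunct2[OF conjunct2[OF h]] \<open>\<nu> \<in> B\<close>] by (elim bexE)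
    then show ?thesis by auto
  qed
  have "\<exists>h'. (\<forall>k\<in>topspace K. h' k \<in> B) \<and> coordinatewise_continuous K UNIV h' \<and>
      (\<forall>k\<in>topspace K. \<forall>i\<in>x ` {..<n}. cmod (h' k i - h k i) \<le> (1 / 2) ^ n) \<and> (\<forall>\<nu>\<in>F. \<exists>q\<in>P. h' q = \<nu>)"
    by (rule attain_targets) (use h F near in auto)
  then obtain h' where h': "\<forall>k\<in>topspace K. h' k \<in> B" "coordinatewise_continuous K UNIV h'"
    "\<forall>k\<in>topspace K. \<forall>i\<in>x ` {..<n}. cmod (h' k i - h k i) \<le> (1 / 2) ^ n"
    "\<forall>\<nu>\<in>F. \<exists>q\<in>P. h' q = \<nu>"
    by (elim exE conjE)
  \<comment> \<open>The net points are attained exactly, so the distance to \<psi> is just the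
    fineness of the net.\<close>
  have "\<exists>p\<in>P. \<forall>j<Suc n. cmod (h' p (x j) - \<psi> (x j)) < (1 / 2) ^ Suc n" if \<psi>: "\<psi> \<in> B" for \<psi>
  proof -
    obtain \<nu> where "\<nu> \<in> F" "\<forall>j<Suc n. cmod (\<nu> (x j) - \<psi> (x j)) < (1 / 2) ^ Suc n"
      using bspec[OF F(3) \<psi>] by (elim bexE)
    moreover obtain p where "p \<in> P" "h' p = \<nu>"
      using h'(4) \<open>\<nu> \<in> F\<close> by blast
    ultimately show ?thesis by blast
  qed
  with h'(1-3) show "\<exists>h'. ?R (Suc n) h' \<and> ?S n h h'"
    by (intro exI[of _ h'] conjI) simp_all
qed

text \<open>The moves are summable, so convergence is uniform on K in each coordinate
  \<open>x j\<close>, and \<open>dense\<close> carries it over to every coordinate in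
  \<open>I\<close>. Since \<open>B\<close> is not assumed closed under limits, the approximants h
  are part of the conclusion: properties of members of \<open>B\<close> reach g through
  them.\<close>

theorem dense_parametrization:
  fixes x :: "nat \<Rightarrow> 'i"
  assumes ne: "B \<noteq> {}" and bdd: "\<And>\<phi> j. \<phi> \<in> B \<Longrightarrow> cmod (\<phi> (x j)) \<le> M j"
    and dense: "\<And>i \<epsilon>. i \<in> I \<Longrightarrow> \<epsilon> > 0 \<Longrightarrow> \<exists>j. \<forall>\<phi>\<in>B. cmod (\<phi> i - \<phi> (x j)) < \<epsilon>"
  shows "\<exists>h g. (\<forall>n. \<forall>k\<in>topspace K. h n k \<in> B) \<and>
    (\<forall>k\<in>topspace K. \<forall>i\<in>I. (\<lambda>n. h n k i) \<longlonglongrightarrow> g k i) \<and>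
    coordinatewise_continuous K I g \<and>
    (\<forall>\<phi>\<in>B. \<forall>S \<epsilon>. finite S \<longrightarrow> S \<subseteq> I \<longrightarrow> \<epsilon> > 0 \<longrightarrow>
      (\<exists>p\<in>topspace K. \<forall>i\<in>S. cmod (g p i - \<phi> i) < \<epsilon>))"
proof -
  have "\<exists>h. \<forall>n. ((\<forall>k\<in>topspace K. h n k \<in> B) \<and> coordinatewise_continuous K UNIV (h n) \<and>
      (\<forall>\<psi>\<in>B. \<exists>p\<in>P. \<forall>j<n. cmod (h n p (x j) - \<psi> (x j)) < (1 / 2) ^ n)) \<and>
    (\<forall>k\<in>topspace K. \<forall>j<n. cmod (h (Suc n) k (x j) - h n k (x j)) \<le> (1 / 2) ^ n)"
    by (rule refining_sequence[OF ne bdd])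
  then obtain h where h: "\<forall>n. ((\<forall>k\<in>topspace K. h n k \<in> B) \<and> coordinatewise_continuous K UNIV (h n) \<and>
      (\<forall>\<psi>\<in>B. \<exists>p\<in>P. \<forall>j<n. cmod (h n p (x j) - \<psi> (x j)) < (1 / 2) ^ n)) \<and>
    (\<forall>k\<in>topspace K. \<forall>j<n. cmod (h (Suc n) k (x j) - h n k (x j)) \<le> (1 / 2) ^ n)" ..
  have hB: "\<And>n k. k \<in> topspace K \<Longrightarrow> h n k \<in> B"
    and hc: "\<And>n. coordinatewise_continuous K UNIV (h n)"
    and net: "\<And>n \<psi>. \<psi> \<in> B \<Longrightarrow> \<exists>p\<in>P. \<forall>j<n. cmod (h n p (x j) - \<psi> (x j)) < (1 / 2) ^ n"
    and step: "\<And>n k j. k \<in> topspace K \<Longrightarrow> j < n \<Longrightarrow>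
      cmod (h (Suc n) k (x j) - h n k (x j)) \<le> (1 / 2) ^ n"
    by (simp_all add: h)
  \<comment> \<open>The right-hand side is the sum of (1 / 2) ^ m for m from n up to n + d -
    1.\<close>
  have tail: "cmod (h (n + d) k (x j) - h n k (x j)) \<le> 2 * (1 / 2) ^ n - 2 * (1 / 2) ^ (n + d)"
    if "k \<in> topspace K" "j < n" for n d k j
  proof (induction d)
    case (Suc d)
    have "cmod (h (Suc (n + d)) k (x j) - h n k (x j))
        \<le> cmod (h (Suc (n + d)) k (x j) - h (n + d) k (x j)) + cmod (h (n + d) k (x j) - h n k (x j))"
      using norm_triangle_ineq[of "h (Suc (n + d)) k (x j) - h (n + d) k (x j)"
          "h (n + d) k (x j) - h n k (x j)"] by simp
    also have "\<dots> \<le> (1 / 2) ^ (n + d) + (2 * (1 / 2) ^ n - 2 * (1 / 2) ^ (n + d))"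
      using Suc.IH step[of k j "n + d"] that by (intro add_mono) auto
    finally show ?case by simp
  qed simp
  have cauchy: "\<exists>N0. \<forall>N\<ge>N0. \<forall>n\<ge>N. \<forall>k\<in>topspace K. cmod (h n k i - h N k i) < \<epsilon>"
    if i: "i \<in> I" and "\<epsilon> > 0" for i \<epsilon>
  proof -
    obtain j where j: "\<And>\<phi>. \<phi> \<in> B \<Longrightarrow> cmod (\<phi> i - \<phi> (x j)) < \<epsilon> / 3"
      using dense[OF i, of "\<epsilon> / 3"] \<open>\<epsilon> > 0\<close> by auto
    \<comment> \<open>Twice this bounds the tail, which leaves one third of \<epsilon> for it and
      one for each of the two replacements of i by \<open>x j\<close>.\<close>
    obtain N1 where N1: "(1 / 2) ^ N1 < \<epsilon> / 6"
      using real_arch_pow_inv[of "\<epsilon> / 6" "1 / 2"] \<open>\<epsilon> > 0\<close> by auto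
    have "cmod (h n k i - h N k i) < \<epsilon>" if N: "N \<ge> max N1 (Suc j)" "n \<ge> N" and k: "k \<in> topspace K" for n N k
    proof -
      have "(1 / 2 :: real) ^ N \<le> (1 / 2) ^ N1" using N by (intro power_decreasing) auto
      moreover have "0 < (1 / 2 :: real) ^ n" by simp
      moreover have "cmod (h n k (x j) - h N k (x j)) \<le> 2 * (1 / 2) ^ N - 2 * (1 / 2) ^ n"
        using tail[OF k, of j N "n - N"] N by simp
      ultimately have 1: "cmod (h n k (x j) - h N k (x j)) < \<epsilon> / 3"
        using N1 by linarith
      have "cmod (h n k i - h N k i) \<le> cmod (h n k i - h n k (x j))
          + cmod (h n k (x j) - h N k (x j)) + cmod (h N k i - h N k (x j))"
        by norm
      then show ?thesis
        using 1 j[OF hB[OF k, of n]] j[OF hB[OF k, of N]] by simp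
    qed
    then show ?thesis by blast
  qed
  define g where "g k i = lim (\<lambda>n. h n k i)" for k i
  have lim: "(\<lambda>n. h n k i) \<longlonglongrightarrow> g k i" if k: "k \<in> topspace K" and i: "i \<in> I" for k i
  proof -
    have "Cauchy (\<lambda>n. h n k i)"
      unfolding Cauchy_altdef2
    proof (intro allI impI)
      fix e :: real assume "e > 0"
      then obtain N0 where "\<forall>N\<ge>N0. \<forall>n\<ge>N. \<forall>k\<in>topspace K. cmod (h n k i - h N k i) < e"
        using cauchy[OF i] by blast
      then show "\<exists>N. \<forall>n\<ge>N. dist (h n k i) (h N k i) < e"
        using k by (auto simp: dist_norm)
    qed
    then show ?thesis
      unfolding g_def by (simp add: Cauchy_convergent_iff convergent_LIMSEQ_iff)
  qed
  have unif: "\<exists>N0. \<forall>N\<ge>N0. \<forall>k\<in>topspace K. cmod (h N k i - g k i) < \<epsilon>"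
    if i: "i \<in> I" and "\<epsilon> > 0" for i \<epsilon>
  proof -
    obtain N0 where N0: "\<forall>N\<ge>N0. \<forall>n\<ge>N. \<forall>k\<in>topspace K. cmod (h n k i - h N k i) < \<epsilon> / 2"
      using cauchy[OF i, of "\<epsilon> / 2"] \<open>\<epsilon> > 0\<close> by auto
    have "cmod (h N k i - g k i) < \<epsilon>" if N: "N \<ge> N0" and k: "k \<in> topspace K" for N k
    proof -
      have "(\<lambda>n. cmod (h n k i - h N k i)) \<longlonglongrightarrow> cmod (g k i - h N k i)"
        by (intro tendsto_intros lim[OF k i])
      moreover have "\<forall>n\<ge>N. cmod (h n k i - h N k i) \<le> \<epsilon> / 2"
        using N0 N k by (auto intro: less_imp_le)
      ultimately have "cmod (g k i - h N k i) \<le> \<epsilon> / 2"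
        using LIMSEQ_le_const2 by blast
      then show ?thesis using \<open>\<epsilon> > 0\<close> by (simp add: norm_minus_commute)
    qed
    then show ?thesis by blast
  qed
  have cont: "coordinatewise_continuous K I g"
    unfolding coordinatewise_continuous_def
  proof
    fix i assume i: "i \<in> I"
    have "continuous_map K Met_TC.mtopology (\<lambda>k. g k i)"
    proof (rule Met_TC.continuous_map_uniform_limit)
      show "\<forall>\<^sub>F n in sequentially. continuous_map K Met_TC.mtopology (\<lambda>k. h n k i)"
        using hc by (simp add: coordinatewise_continuous_def)
      show "\<forall>\<^sub>F n in sequentially. \<forall>k\<in>topspace K. g k i \<in> UNIV \<and> dist (h n k i) (g k i) < \<epsilon>"
        if "\<epsilon> > 0" for \<epsilon>
        using unif[OF i that] by (auto simp: eventually_sequentially dist_norm)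
    qed simp
    then show "continuous_map K euclidean (\<lambda>k. g k i)" by simp
  qed
  have approx: "\<exists>p\<in>topspace K. \<forall>i\<in>S. cmod (g p i - \<phi> i) < \<epsilon>"
    if \<phi>: "\<phi> \<in> B" and S: "finite S" "S \<subseteq> I" and "\<epsilon> > 0" for \<phi> S \<epsilon>
  proof -
    have e4: "\<epsilon> / 4 > 0" using \<open>\<epsilon> > 0\<close> by simp
    have "\<forall>i\<in>S. \<exists>j. \<forall>\<phi>\<in>B. cmod (\<phi> i - \<phi> (x j)) < \<epsilon> / 4"
      using dense[OF _ e4] S by blast
    then obtain J where J: "\<And>i \<phi>. i \<in> S \<Longrightarrow> \<phi> \<in> B \<Longrightarrow> cmod (\<phi> i - \<phi> (x (J i))) < \<epsilon> / 4"
      by metis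
    have "\<forall>i\<in>S. \<exists>N0. \<forall>N\<ge>N0. \<forall>k\<in>topspace K. cmod (h N k i - g k i) < \<epsilon> / 4"
      using unif[OF _ e4] S by blast
    then obtain N0 where N0: "\<And>i N k. i \<in> S \<Longrightarrow> N \<ge> N0 i \<Longrightarrow> k \<in> topspace K \<Longrightarrow>
        cmod (h N k i - g k i) < \<epsilon> / 4"
      by metis
    obtain N1 where N1: "(1 / 2) ^ N1 < \<epsilon> / 4"
      using real_arch_pow_inv[of "\<epsilon> / 4" "1 / 2"] e4 by auto
    \<comment> \<open>\<open>N\<close> must exceed each \<open>J i\<close> strictly, since stage
      \<open>N\<close> controls only coordinates with index below \<open>N\<close>. The four errors
      in the final estimate are each less than a quarter of \<epsilon>.\<close>
    define N where "N = Max (insert N1 (N0 ` S \<union> (Suc \<circ> J) ` S))"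
    have N: "N1 \<le> N" "\<And>i. i \<in> S \<Longrightarrow> N0 i \<le> N" "\<And>i. i \<in> S \<Longrightarrow> J i < N"
      using S(1) by (auto simp: N_def Suc_le_eq[symmetric] intro!: Max_ge)
    obtain p where p: "p \<in> P" "\<forall>j<N. cmod (h N p (x j) - \<phi> (x j)) < (1 / 2) ^ N"
      using net[OF \<phi>] by blast
    have pK: "p \<in> topspace K" using p P_subset by blast
    have "cmod (g p i - \<phi> i) < \<epsilon>" if i: "i \<in> S" for i
    proof -
      have "(1 / 2 :: real) ^ N \<le> (1 / 2) ^ N1" using N by (intro power_decreasing) auto
      then have 1: "cmod (h N p (x (J i)) - \<phi> (x (J i))) < \<epsilon> / 4"
        using p(2)[rule_format, OF N(3)[OF i]] N1 by linarith
      have "cmod (g p i - \<phi> i) \<le> cmod (h N p i - h N p (x (J i)))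
          + cmod (h N p (x (J i)) - \<phi> (x (J i))) + cmod (h N p i - g p i) + cmod (\<phi> i - \<phi> (x (J i)))"
        by norm
      then show ?thesis
        using 1 J[OF i hB[OF pK, of N]] J[OF i \<phi>] N0[OF i N(2)[OF i] pK] by simp
    qed
    with pK show ?thesis by blast
  qed
  show ?thesis
    by (intro exI[of _ h] exI[of _ g] conjI ballI allI impI; (rule hB lim cont approx; assumption)?)
qed

end

section \<open>Phase retrieval on the dual unit ball\<close>

text \<open>The number b only certifies that the supremum is taken over a bounded set.\<close>

lemma sup_norm_upper:
  assumes "\<And>k. k \<in> topspace K \<Longrightarrow> cmod (f k) \<le> b" "k \<in> topspace K"
  shows "cmod (f k) \<le> sup_norm K f"
proof -
  have "bdd_above ((\<lambda>k. cmod (f k)) ` topspace K)"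
    using assms(1) by (rule bdd_aboveI2)
  from cSUP_upper[OF assms(2) this] assms(2) show ?thesis
    by (auto simp: sup_norm_def)
qed

text \<open>Nonnegativity of b covers the empty space, where the norm is 0 by convention.\<close>

lemma sup_norm_least:
  assumes "\<And>k. k \<in> topspace K \<Longrightarrow> cmod (f k) \<le> b" "0 \<le> b"
  shows "sup_norm K f \<le> b"
  using assms by (auto simp: sup_norm_def intro: cSUP_least)

lemma sup_norm_cong:
  "(\<And>k. k \<in> topspace K \<Longrightarrow> f k = g k) \<Longrightarrow> sup_norm K f = sup_norm K g"
  by (auto simp: sup_norm_def intro: SUP_cong)

sublocale complex_normed_space \<subseteq> complex_vector_space V
  by unfold_locales

section \<open>The unit ball of the dual space\<close>

context complex_normed_space
begin

lemma seminorm_vnorm: "seminorm (vnorm V)"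
  by (simp add: seminorm_def vnorm_smult vnorm_triangle)

lemma vnorm_zero [simp]: "vnorm V \<zero> = 0"
  by (simp add: vnorm_eq_0_iff)

lemma vnorm_nonneg: "x \<in> carrier V \<Longrightarrow> 0 \<le> vnorm V x"
  using vnorm_triangle[of x "(-1) \<odot> x"] vnorm_smult[of x "-1"] by simp

text \<open>Values off the carrier are arbitrary, so a function that is a limit of members of the
  ball on the carrier alone is again a member.\<close>

definition dual_ball :: "('v \<Rightarrow> complex) set" where
  "dual_ball = {\<phi>. functional \<phi> \<and> (\<forall>x\<in>carrier V. cmod (\<phi> x) \<le> vnorm V x)}"

lemma dual_ball_functional: "\<phi> \<in> dual_ball \<Longrightarrow> functional \<phi>"
  by (simp add: dual_ball_def)

lemma dual_ball_le: "\<phi> \<in> dual_ball \<Longrightarrow> x \<in> carrier V \<Longrightarrow> cmod (\<phi> x) \<le> vnorm V x"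
  by (simp add: dual_ball_def)

lemma functional_combination:
  "functional \<phi> \<Longrightarrow> x \<in> carrier V \<Longrightarrow> y \<in> carrier V \<Longrightarrow> \<phi> (x \<oplus> c \<odot> y) = \<phi> x + c * \<phi> y"
  by (simp add: functional_add functional_smult)

lemma dual_ball_diff:
  assumes "\<phi> \<in> dual_ball" "x \<in> carrier V" "y \<in> carrier V"
  shows "cmod (\<phi> x - \<phi> y) \<le> vnorm V (x \<ominus> y)"
proof -
  have "\<phi> (x \<oplus> (-1) \<odot> y) = \<phi> x - \<phi> y"
    using functional_combination[OF dual_ball_functional[OF assms(1)] assms(2,3), of "-1"] by simp
  then show ?thesis
    using dual_ball_le[OF assms(1), of "x \<oplus> (-1) \<odot> y"] assms by (simp add: minus_eq_smult)
qed

lemma zero_in_dual_ball: "(\<lambda>_. 0) \<in> dual_ball"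
  by (simp add: dual_ball_def functional_def vnorm_nonneg)

lemma dual_ball_convex:
  assumes \<phi>: "\<phi> \<in> dual_ball" and \<psi>: "\<psi> \<in> dual_ball" and t: "0 \<le> t" "t \<le> 1"
  shows "(\<lambda>x. complex_of_real (1 - t) * \<phi> x + complex_of_real t * \<psi> x) \<in> dual_ball"
proof -
  have "cmod (complex_of_real (1 - t) * \<phi> x + complex_of_real t * \<psi> x) \<le> vnorm V x"
    if x: "x \<in> carrier V" for x
  proof -
    have "cmod (complex_of_real (1 - t) * \<phi> x + complex_of_real t * \<psi> x)
        \<le> (1 - t) * cmod (\<phi> x) + t * cmod (\<psi> x)"
      using norm_triangle_ineq[of "complex_of_real (1 - t) * \<phi> x" "complex_of_real t * \<psi> x"] t
      by (simp add: norm_mult del: of_real_diff)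
    also have "\<dots> \<le> (1 - t) * vnorm V x + t * vnorm V x"
      using t dual_ball_le[OF \<phi> x] dual_ball_le[OF \<psi> x] by (intro add_mono mult_left_mono) auto
    finally show ?thesis by (simp add: algebra_simps)
  qed
  moreover have "functional (\<lambda>x. complex_of_real (1 - t) * \<phi> x + complex_of_real t * \<psi> x)"
    using dual_ball_functional[OF \<phi>] dual_ball_functional[OF \<psi>]
    by (simp add: functional_def algebra_simps)
  ultimately show ?thesis by (simp add: dual_ball_def)
qed

lemma norming_functional:
  assumes "x \<in> carrier V"
  shows "\<exists>\<phi>\<in>dual_ball. \<phi> x = vnorm V x"
  by (rule hahn_banach[OF seminorm_vnorm assms]) (auto simp: dual_ball_def)

text \<open>The distance to the line spanned by y is a seminorm below the norm that vanishes at y: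
  the quotient norm, without the quotient. Hahn-Banach for this seminorm at x gives the
  functional.\<close>

lemma annihilating_functional:
  assumes x: "x \<in> carrier V" and y: "y \<in> carrier V"
  shows "\<exists>\<phi>\<in>dual_ball. \<phi> y = 0 \<and> \<phi> x = (INF c. vnorm V (x \<oplus> c \<odot> y))"
proof -
  define p where "p z = (INF c. vnorm V (z \<oplus> c \<odot> y))" for z
  have lower: "p z \<le> vnorm V (z \<oplus> c \<odot> y)" if "z \<in> carrier V" for z c
    unfolding p_def using that y by (intro cINF_lower bdd_belowI2[of _ 0]) (auto intro: vnorm_nonneg)
  have greatest: "m \<le> p z" if "\<And>c. m \<le> vnorm V (z \<oplus> c \<odot> y)" for m z
    unfolding p_def by (rule cINF_greatest) (use that in auto)
  have p_le: "p z \<le> vnorm V z" if "z \<in> carrier V" for z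
    using lower[OF that, of 0] that y by simp
  have p_nonneg: "0 \<le> p z" if "z \<in> carrier V" for z
    by (rule greatest) (use that y in \<open>simp add: vnorm_nonneg\<close>)
  \<comment> \<open>For nonzero a, multiplication by a permutes the multiples of y. The reverse
    inequality follows later by using the inverse of a.\<close>
  have p_scale_le: "p (a \<odot> z) \<le> cmod a * p z" if z: "z \<in> carrier V" and a: "a \<noteq> 0" for a z
  proof -
    have "p (a \<odot> z) / cmod a \<le> p z"
    proof (rule greatest)
      fix c
      have "a \<odot> z \<oplus> (a * c) \<odot> y = a \<odot> (z \<oplus> c \<odot> y)"
        using z y by (simp add: smult_add_right smult_smult)
      then have "p (a \<odot> z) \<le> cmod a * vnorm V (z \<oplus> c \<odot> y)"
        using lower[of "a \<odot> z" "a * c"] z y by (simp add: vnorm_smult)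
      then show "p (a \<odot> z) / cmod a \<le> vnorm V (z \<oplus> c \<odot> y)"
        using a by (simp add: field_simps)
    qed
    then show ?thesis using a by (simp add: field_simps)
  qed
  have "seminorm p"
    unfolding seminorm_def
  proof (intro conjI ballI allI)
    fix u v assume u: "u \<in> carrier V" and v: "v \<in> carrier V"
    have *: "p (u \<oplus> v) \<le> vnorm V (u \<oplus> a \<odot> y) + vnorm V (v \<oplus> b \<odot> y)" for a b
    proof -
      have "(u \<oplus> v) \<oplus> (a + b) \<odot> y = (u \<oplus> a \<odot> y) \<oplus> (v \<oplus> b \<odot> y)"
        using u v y by (simp add: smult_add_left M.a_ac)
      then show ?thesis
        using lower[of "u \<oplus> v" "a + b"] vnorm_triangle[of "u \<oplus> a \<odot> y" "v \<oplus> b \<odot> y"] u v y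
        by simp
    qed
    have "p (u \<oplus> v) - p u \<le> p v"
    proof (rule greatest)
      fix b
      have "p (u \<oplus> v) - vnorm V (v \<oplus> b \<odot> y) \<le> p u"
        by (rule greatest) (use *[of _ b] in \<open>simp add: algebra_simps\<close>)
      then show "p (u \<oplus> v) - p u \<le> vnorm V (v \<oplus> b \<odot> y)" by simp
    qed
    then show "p (u \<oplus> v) \<le> p u + p v" by simp
  next
    fix z a assume z: "z \<in> carrier V"
    show "p (a \<odot> z) = cmod a * p z"
    proof (cases "a = 0")
      case True
      then show ?thesis
        using p_le[of \<zero>] p_nonneg[of \<zero>] z by simp
    next
      case False
      have "p z \<le> cmod (inverse a) * p (a \<odot> z)"
        using p_scale_le[of "a \<odot> z" "inverse a"] z False by (simp add: smult_smult)
      then have "cmod a * p z \<le> p (a \<odot> z)"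
        using False by (simp add: norm_divide field_simps)
      then show ?thesis
        using p_scale_le[OF z False] by simp
    qed
  qed
  from hahn_banach[OF this x]
  obtain \<phi> where \<phi>: "functional \<phi>" "\<And>z. z \<in> carrier V \<Longrightarrow> cmod (\<phi> z) \<le> p z" "\<phi> x = p x"
    by metis
  have "p y \<le> 0"
    using lower[OF y, of "-1"] y by simp
  with \<phi>(2)[OF y] have "cmod (\<phi> y) \<le> 0" by linarith
  then have "\<phi> y = 0" by simp
  moreover have "\<phi> \<in> dual_ball"
    using \<phi>(1,2) p_le by (auto simp: dual_ball_def intro: order_trans)
  ultimately show ?thesis
    using \<phi>(3) by (auto simp: p_def)
qed

text \<open>A functional annihilating y and norming x modulo y shows that x is within e of the line
  through y; a functional norming y shows that the coefficient on that line is almost unimodular.\<close>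

lemma dual_ball_phase_retrieval:
  assumes x: "x \<in> carrier V" and y: "y \<in> carrier V" and "\<eta> > 0"
    and e: "\<And>\<phi>. \<phi> \<in> dual_ball \<Longrightarrow> \<bar>cmod (\<phi> x) - cmod (\<phi> y)\<bar> \<le> e"
  shows "\<exists>l. cmod l = 1 \<and> vnorm V (x \<oplus> (- l) \<odot> y) \<le> 3 * (e + \<eta>)"
proof -
  obtain \<phi> where \<phi>: "\<phi> \<in> dual_ball" "\<phi> y = 0" "\<phi> x = (INF c. vnorm V (x \<oplus> c \<odot> y))"
    using annihilating_functional[OF x y] by blast
  have "(INF c. vnorm V (x \<oplus> c \<odot> y)) \<le> e"
    using e[OF \<phi>(1)] \<phi>(2,3) by simp
  \<comment> \<open>The slack \<eta> lets a coefficient c be picked whether or not the infimum is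
    attained.\<close>
  then have "(INF c. vnorm V (x \<oplus> c \<odot> y)) < e + \<eta>"
    using \<open>\<eta> > 0\<close> by linarith
  then obtain c where "vnorm V (x \<oplus> c \<odot> y) < e + \<eta>"
    using x y by (subst (asm) cINF_less_iff) (auto intro!: bdd_belowI2[of _ 0] vnorm_nonneg)
  moreover define d where "d = - c"
  ultimately have d: "vnorm V (x \<oplus> (- d) \<odot> y) < e + \<eta>"
    by simp
  obtain \<psi> where \<psi>: "\<psi> \<in> dual_ball" "\<psi> y = vnorm V y"
    using norming_functional[OF y] by blast
  have "cmod (\<psi> x - d * \<psi> y) \<le> e + \<eta>"
    using dual_ball_le[OF \<psi>(1), of "x \<oplus> (- d) \<odot> y"] d x y
      functional_combination[OF dual_ball_functional[OF \<psi>(1)] x y, of "- d"] by simp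
  then have "\<bar>cmod (\<psi> x) - cmod (d * \<psi> y)\<bar> \<le> e + \<eta>"
    using norm_triangle_ineq3[of "\<psi> x" "d * \<psi> y"] by linarith
  \<comment> \<open>The modulus of \<psi> x is within e + \<eta> of that of d \<psi> y, and within e
    of the norm of y because \<psi> norms y.\<close>
  then have "\<bar>cmod d * vnorm V y - vnorm V y\<bar> \<le> e + (e + \<eta>)"
    using e[OF \<psi>(1)] \<psi>(2) vnorm_nonneg[OF y] by (simp add: norm_mult)
  then have 1: "\<bar>cmod d - 1\<bar> * vnorm V y \<le> e + (e + \<eta>)"
    using vnorm_nonneg[OF y] abs_mult[of "cmod d - 1" "vnorm V y"] by (simp add: left_diff_distrib)
  \<comment> \<open>The phase of d, the unit scalar nearest to d. For d = 0 any unit scalar is at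
    distance 1, so the formula for \<open>cmod (d - l)\<close> persists.\<close>
  define l where "l = (if d = 0 then 1 else d / cmod d)"
  have l: "cmod l = 1"
    by (simp add: l_def norm_divide)
  have "cmod (d - l) = \<bar>cmod d - 1\<bar>"
  proof -
    have "d - l = (complex_of_real (cmod d) - 1) * l"
      by (simp add: l_def algebra_simps)
    then have "cmod (d - l) = cmod (complex_of_real (cmod d - 1))"
      using l by (simp add: norm_mult)
    then show ?thesis by (simp only: norm_of_real)
  qed
  \<comment> \<open>The two costs are e + \<eta> for reaching d y and 2 e + \<eta> for passing from
    d to l.\<close>
  have "x \<oplus> (- l) \<odot> y = (x \<oplus> (- d) \<odot> y) \<oplus> (d - l) \<odot> y"
    using x y smult_add_left[OF y, of "- d" "d - l"] by (simp add: M.a_assoc)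
  then have "vnorm V (x \<oplus> (- l) \<odot> y) \<le> vnorm V (x \<oplus> (- d) \<odot> y) + cmod (d - l) * vnorm V y"
    using vnorm_triangle[of "x \<oplus> (- d) \<odot> y" "(d - l) \<odot> y"] x y by (simp add: vnorm_smult)
  also have "\<dots> \<le> 3 * (e + \<eta>)"
    using d 1 \<open>cmod (d - l) = _\<close> \<open>\<eta> > 0\<close> by simp
  finally show ?thesis using l by blast
qed

end

section \<open>The embedding given by a dense map into the dual ball\<close>

lemma linear_isometry_range_submodule:
  assumes V: "complex_normed_space V" and W: "complex_normed_space W" and T: "linear_isometry V W T"
  shows "submodule (T ` carrier V) complex_ring W"
proof -
  interpret V: complex_normed_space V by fact
  interpret W: complex_normed_space W by fact
  have closed: "\<And>x. x \<in> carrier V \<Longrightarrow> T x \<in> carrier W"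
    and add: "\<And>x y. x \<in> carrier V \<Longrightarrow> y \<in> carrier V \<Longrightarrow> T x \<oplus>\<^bsub>W\<^esub> T y = T (x \<oplus>\<^bsub>V\<^esub> y)"
    and scale: "\<And>c x. x \<in> carrier V \<Longrightarrow> c \<odot>\<^bsub>W\<^esub> T x = T (c \<odot>\<^bsub>V\<^esub> x)"
    using T by (auto simp: linear_isometry_def)
  have zero: "\<zero>\<^bsub>W\<^esub> = T \<zero>\<^bsub>V\<^esub>"
    using scale[of "\<zero>\<^bsub>V\<^esub>" 0] closed[of "\<zero>\<^bsub>V\<^esub>"] by simp
  show ?thesis
    by (rule W.submoduleI) (auto simp: closed zero add scale W.uminus_eq_smult)
qed

lemma separable_dense_sequence:
  assumes "separable_complex_banach V"
  shows "\<exists>x. (\<forall>j::nat. x j \<in> carrier V) \<and> (\<forall>z\<in>carrier V. \<forall>\<epsilon>>0. \<exists>j. vnorm V (z \<ominus>\<^bsub>V\<^esub> x j) < \<epsilon>)"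
proof -
  interpret V: complex_normed_space V
    using assms by (simp add: separable_complex_banach_def)
  interpret M: Metric_space "carrier V" "vdist V"
    by (rule complex_normed_space_Metric_space) unfold_locales
  obtain D where D: "countable D" "D \<subseteq> carrier V" "M.mtopology closure_of D = carrier V"
    using assms by (auto simp: separable_complex_banach_def separable_space_def)
  have near: "\<exists>y\<in>D. vnorm V (z \<ominus>\<^bsub>V\<^esub> y) < \<epsilon>" if z: "z \<in> carrier V" and "\<epsilon> > 0" for z \<epsilon>
  proof -
    have "\<exists>y\<in>D. y \<in> M.mball z \<epsilon>"
      using D(3) z \<open>\<epsilon> > 0\<close> unfolding M.metric_closure_of by blast
    then show ?thesis by (auto simp: vdist_def)
  qed
  \<comment> \<open>The carrier contains zero, so the dense set is nonempty and can be enumerated by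
    all natural numbers.\<close>
  have "D \<noteq> {}" using near[of "\<zero>\<^bsub>V\<^esub>" 1] by auto
  then have "range (from_nat_into D) = D"
    using D(1) by (rule range_from_nat_into)
  then have "\<exists>j. vnorm V (z \<ominus>\<^bsub>V\<^esub> from_nat_into D j) < \<epsilon>" if "z \<in> carrier V" "\<epsilon> > 0" for z \<epsilon>
    using near[OF that] by (metis rangeE)
  moreover have "from_nat_into D j \<in> carrier V" for j
    using from_nat_into[OF \<open>D \<noteq> {}\<close>] D(2) by blast
  ultimately show ?thesis by (intro exI[of _ "from_nat_into D"]) blast
qed

text \<open>A vector z is sent to the function k \<mapsto> g k z. Since the g k are dense in the
  dual ball, suprema over K agree with suprema over the ball, where norms and phases are
  recovered.\<close>

theorem isometric_SPR_copy_of_perfect_set: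
  assumes K: "compact_space K" "Hausdorff_space K" "perfect_set_in K P"
    and V: "separable_complex_banach V"
  shows "contains_isometric_SPR_copy K V"
proof -
  interpret V: complex_normed_space V
    using V by (simp add: separable_complex_banach_def)
  interpret pc: perfect_convex K P V.dual_ball
    using K V.dual_ball_convex by unfold_locales auto
  obtain x where x: "\<forall>j::nat. x j \<in> carrier V"
    and x_dense: "\<forall>z\<in>carrier V. \<forall>\<epsilon>>0. \<exists>j. vnorm V (z \<ominus>\<^bsub>V\<^esub> x j) < \<epsilon>"
    using separable_dense_sequence[OF V] by (elim exE conjE)
  have dense: "\<exists>j. \<forall>\<phi>\<in>V.dual_ball. cmod (\<phi> z - \<phi> (x j)) < \<epsilon>"
    if z: "z \<in> carrier V" and \<epsilon>: "\<epsilon> > 0" for z \<epsilon>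
  proof -
    obtain j where "vnorm V (z \<ominus>\<^bsub>V\<^esub> x j) < \<epsilon>" using x_dense z \<epsilon> by blast
    then show ?thesis
      using V.dual_ball_diff[OF _ z, of _ "x j"] x by (intro exI[of _ j]) fastforce
  qed
  have bdd: "cmod (\<phi> (x j)) \<le> vnorm V (x j)" if "\<phi> \<in> V.dual_ball" for \<phi> j
    using V.dual_ball_le[OF that] x by blast
  have ne: "V.dual_ball \<noteq> {}" using V.zero_in_dual_ball by blast
  have "\<exists>h g. (\<forall>n. \<forall>k\<in>topspace K. h n k \<in> V.dual_ball) \<and>
    (\<forall>k\<in>topspace K. \<forall>i\<in>carrier V. (\<lambda>n. h n k i) \<longlonglongrightarrow> g k i) \<and>
    coordinatewise_continuous K (carrier V) g \<and>
    (\<forall>\<phi>\<in>V.dual_ball. \<forall>S \<epsilon>. finite S \<longrightarrow> S \<subseteq> carrier V \<longrightarrow> \<epsilon> > 0 \<longrightarrow>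
      (\<exists>p\<in>topspace K. \<forall>i\<in>S. cmod (g p i - \<phi> i) < \<epsilon>))"
    by (rule pc.dense_parametrization[of x "\<lambda>j. vnorm V (x j)"]) (fact ne bdd dense)+
  then obtain h g where h: "\<forall>n. \<forall>k\<in>topspace K. h n k \<in> V.dual_ball"
    and lim: "\<forall>k\<in>topspace K. \<forall>i\<in>carrier V. (\<lambda>n. h n k i) \<longlonglongrightarrow> g k i"
    and cont: "coordinatewise_continuous K (carrier V) g"
    and approx: "\<forall>\<phi>\<in>V.dual_ball. \<forall>S \<epsilon>. finite S \<longrightarrow> S \<subseteq> carrier V \<longrightarrow> \<epsilon> > 0 \<longrightarrow>
      (\<exists>p\<in>topspace K. \<forall>i\<in>S. cmod (g p i - \<phi> i) < \<epsilon>)"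
    by (elim exE conjE)
  \<comment> \<open>Linearity and the norm bound are closed conditions and pass from the
    approximants to their pointwise limit.\<close>
  have g_ball: "g k \<in> V.dual_ball" if k: "k \<in> topspace K" for k
  proof -
    have hf: "V.functional (h n k)" for n
      using h k V.dual_ball_functional by blast
    have "g k (u \<oplus>\<^bsub>V\<^esub> v) = g k u + g k v" if "u \<in> carrier V" "v \<in> carrier V" for u v
    proof (rule LIMSEQ_unique)
      show "(\<lambda>n. h n k (u \<oplus>\<^bsub>V\<^esub> v)) \<longlonglongrightarrow> g k (u \<oplus>\<^bsub>V\<^esub> v)" using lim k that by simp
      show "(\<lambda>n. h n k (u \<oplus>\<^bsub>V\<^esub> v)) \<longlonglongrightarrow> g k u + g k v"
        using lim k that by (simp add: V.functional_add[OF hf] tendsto_add)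
    qed
    moreover have "g k (c \<odot>\<^bsub>V\<^esub> u) = c * g k u" if "u \<in> carrier V" for c u
    proof (rule LIMSEQ_unique)
      show "(\<lambda>n. h n k (c \<odot>\<^bsub>V\<^esub> u)) \<longlonglongrightarrow> g k (c \<odot>\<^bsub>V\<^esub> u)" using lim k that by simp
      show "(\<lambda>n. h n k (c \<odot>\<^bsub>V\<^esub> u)) \<longlonglongrightarrow> c * g k u"
        using lim k that by (simp add: V.functional_smult[OF hf] tendsto_mult_left)
    qed
    moreover have "cmod (g k u) \<le> vnorm V u" if u: "u \<in> carrier V" for u
    proof (rule LIMSEQ_le_const2)
      show "(\<lambda>n. cmod (h n k u)) \<longlonglongrightarrow> cmod (g k u)" using lim k u by (intro tendsto_norm) blast
      show "\<exists>N. \<forall>n\<ge>N. cmod (h n k u) \<le> vnorm V u" using V.dual_ball_le h k u by blast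
    qed
    ultimately show ?thesis by (simp add: V.dual_ball_def V.functional_def)
  qed
  note g_fun = V.dual_ball_functional[OF g_ball]
  have norm_eq: "sup_norm K (\<lambda>k. g k z) = vnorm V z" if z: "z \<in> carrier V" for z
  proof (rule antisym)
    have bound: "cmod (g k z) \<le> vnorm V z" if "k \<in> topspace K" for k
      using V.dual_ball_le[OF g_ball[OF that] z] .
    show "sup_norm K (\<lambda>k. g k z) \<le> vnorm V z"
      by (rule sup_norm_least) (use bound V.vnorm_nonneg[OF z] in auto)
    show "vnorm V z \<le> sup_norm K (\<lambda>k. g k z)"
    proof (rule field_le_epsilon)
      fix \<epsilon> :: real assume \<epsilon>: "\<epsilon> > 0"
      obtain \<phi> where \<phi>: "\<phi> \<in> V.dual_ball" "\<phi> z = vnorm V z"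
        using V.norming_functional[OF z] by blast
      obtain p where p: "p \<in> topspace K" "cmod (g p z - \<phi> z) < \<epsilon>"
        using approx[rule_format, OF \<phi>(1), of "{z}" \<epsilon>] z \<epsilon> by auto
      have "vnorm V z \<le> cmod (\<phi> z)"
        using V.vnorm_nonneg[OF z] \<phi>(2) by simp
      also have "\<dots> \<le> cmod (g p z) + cmod (g p z - \<phi> z)" by norm
      also have "\<dots> \<le> sup_norm K (\<lambda>k. g k z) + \<epsilon>"
        using sup_norm_upper[of K "\<lambda>k. g k z", OF bound p(1)] p(2) by simp
      finally show "vnorm V z \<le> sup_norm K (\<lambda>k. g k z) + \<epsilon>" .
    qed
  qed
  define T where "T z = (\<lambda>k\<in>topspace K. g k z)" for z
  have iso: "linear_isometry V (C_space K) T"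
    unfolding linear_isometry_def
  proof (intro conjI ballI allI Pi_I)
    fix z assume z: "z \<in> carrier V"
    have "continuous_map K euclidean (\<lambda>k. g k z)"
      using cont z by (simp add: coordinatewise_continuous_def)
    then have "continuous_map K euclidean (T z)"
      by (rule continuous_map_eq) (simp add: T_def)
    then show "T z \<in> carrier (C_space K)"
      by (simp add: C_space_def T_def)
    have "sup_norm K (T z) = sup_norm K (\<lambda>k. g k z)"
      by (rule sup_norm_cong) (simp add: T_def)
    then show "vnorm (C_space K) (T z) = vnorm V z"
      using norm_eq[OF z] by (simp add: C_space_def)
  next
    fix u v assume "u \<in> carrier V" "v \<in> carrier V"
    then show "T (u \<oplus>\<^bsub>V\<^esub> v) = T u \<oplus>\<^bsub>C_space K\<^esub> T v"
      by (auto simp: T_def C_space_def V.functional_add[OF g_fun])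
  next
    fix c u assume "u \<in> carrier V"
    then show "T (c \<odot>\<^bsub>V\<^esub> u) = c \<odot>\<^bsub>C_space K\<^esub> T u"
      by (auto simp: T_def C_space_def V.functional_smult[OF g_fun])
  qed
  have SPR: "(INF l\<in>{l. cmod l = 1}. sup_norm K (\<lambda>k. T u k - l * T v k))
      \<le> 3 * sup_norm K (\<lambda>k. complex_of_real (cmod (T u k) - cmod (T v k)))"
    if u: "u \<in> carrier V" and v: "v \<in> carrier V" for u v
  proof -
    define e where "e = sup_norm K (\<lambda>k. complex_of_real (cmod (T u k) - cmod (T v k)))"
    have e_eq: "e = sup_norm K (\<lambda>k. complex_of_real (cmod (g k u) - cmod (g k v)))"
      unfolding e_def by (rule sup_norm_cong) (simp add: T_def)
    have e: "\<bar>cmod (g k u) - cmod (g k v)\<bar> \<le> e" if k: "k \<in> topspace K" for k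
    proof -
      have "cmod (complex_of_real (cmod (g k u) - cmod (g k v))) \<le> vnorm V u + vnorm V v"
        if "k \<in> topspace K" for k
        using V.dual_ball_le[OF g_ball[OF that] u] V.dual_ball_le[OF g_ball[OF that] v]
          norm_ge_zero[of "g k u"] norm_ge_zero[of "g k v"]
        unfolding norm_of_real by linarith
      from sup_norm_upper[of K "\<lambda>k. complex_of_real (cmod (g k u) - cmod (g k v))", OF this k]
      show ?thesis unfolding e_eq norm_of_real .
    qed
    \<comment> \<open>Both coordinates u and v have to be approximated at the same point of K; this
      is why density is stated for finite sets of coordinates.\<close>
    have e_ball: "\<bar>cmod (\<phi> u) - cmod (\<phi> v)\<bar> \<le> e" if \<phi>: "\<phi> \<in> V.dual_ball" for \<phi>
    proof (rule field_le_epsilon)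
      fix \<epsilon> :: real assume \<epsilon>: "\<epsilon> > 0"
      obtain p where p: "p \<in> topspace K" "cmod (g p u - \<phi> u) < \<epsilon> / 2" "cmod (g p v - \<phi> v) < \<epsilon> / 2"
        using approx[rule_format, OF \<phi>, of "{u, v}" "\<epsilon> / 2"] u v \<epsilon> by auto
      show "\<bar>cmod (\<phi> u) - cmod (\<phi> v)\<bar> \<le> e + \<epsilon>"
        using e[OF p(1)] p(2,3) norm_triangle_ineq3[of "g p u" "\<phi> u"]
          norm_triangle_ineq3[of "g p v" "\<phi> v"] by linarith
    qed
    have diff: "sup_norm K (\<lambda>k. T u k - l * T v k) = vnorm V (u \<oplus>\<^bsub>V\<^esub> (- l) \<odot>\<^bsub>V\<^esub> v)" for l
    proof -
      have "sup_norm K (\<lambda>k. T u k - l * T v k) = sup_norm K (\<lambda>k. g k (u \<oplus>\<^bsub>V\<^esub> (- l) \<odot>\<^bsub>V\<^esub> v))"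
        by (rule sup_norm_cong) (simp add: T_def V.functional_combination[OF g_fun u v])
      then show ?thesis using norm_eq u v by simp
    qed
    have "(INF l\<in>{l. cmod l = 1}. vnorm V (u \<oplus>\<^bsub>V\<^esub> (- l) \<odot>\<^bsub>V\<^esub> v)) \<le> 3 * e"
    proof (rule field_le_epsilon)
      fix \<epsilon> :: real assume \<epsilon>: "\<epsilon> > 0"
      then have "\<epsilon> / 3 > 0" by simp
      from V.dual_ball_phase_retrieval[OF u v this e_ball] obtain l
        where l: "cmod l = 1" "vnorm V (u \<oplus>\<^bsub>V\<^esub> (- l) \<odot>\<^bsub>V\<^esub> v) \<le> 3 * (e + \<epsilon> / 3)" by blast
      have "(INF l\<in>{l. cmod l = 1}. vnorm V (u \<oplus>\<^bsub>V\<^esub> (- l) \<odot>\<^bsub>V\<^esub> v)) \<le> vnorm V (u \<oplus>\<^bsub>V\<^esub> (- l) \<odot>\<^bsub>V\<^esub> v)"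
        using l(1) u v by (intro cINF_lower bdd_belowI2[of _ 0]) (auto intro: V.vnorm_nonneg)
      with l(2) show "(INF l\<in>{l. cmod l = 1}. vnorm V (u \<oplus>\<^bsub>V\<^esub> (- l) \<odot>\<^bsub>V\<^esub> v)) \<le> 3 * e + \<epsilon>"
        by simp
    qed
    then show ?thesis
      unfolding diff e_def .
  qed
  have "does_SPR K (T ` carrier V)"
    unfolding does_SPR_def
  proof (intro conjI exI[of _ 3] ballI)
    show "submodule (T ` carrier V) complex_ring (C_space K)"
      by (rule linear_isometry_range_submodule[OF _ C_space_complex_normed_space[OF K(1)] iso])
        unfold_locales
    show "(INF l\<in>{l. cmod l = 1}. sup_norm K (\<lambda>x. a x - l * b x))
        \<le> 3 * sup_norm K (\<lambda>x. complex_of_real (cmod (a x) - cmod (b x)))"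
      if a: "a \<in> T ` carrier V" and b: "b \<in> T ` carrier V" for a b
    proof -
      obtain u v where "u \<in> carrier V" "v \<in> carrier V" "a = T u" "b = T v" using a b by blast
      then show ?thesis using SPR by simp
    qed
  qed simp
  with iso show ?thesis
    unfolding contains_isometric_SPR_copy_def by (intro exI[of _ T] conjI)
qed

section \<open>The Euclidean plane in C(K)\<close>

text \<open>The universally quantified spaces have carriers consisting of complex sequences, so the
  plane is realized by sequences supported on the indices 0 and 1.\<close>

definition pair_seq :: "complex \<times> complex \<Rightarrow> nat \<Rightarrow> complex" where
  "pair_seq p = (\<lambda>i. if i = 0 then fst p else if i = 1 then snd p else 0)"

lemma pair_seq_nth [simp]: "(pair_seq p 0, pair_seq p (Suc 0)) = p"
  by (simp add: pair_seq_def)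

lemma pair_seq_eq_iff [simp]: "pair_seq p = pair_seq q \<longleftrightarrow> p = q"
  by (metis pair_seq_nth)

lemma pair_seq_add: "pair_seq p i + pair_seq q i = pair_seq (p + q) i"
  by (simp add: pair_seq_def)

lemma pair_seq_mult: "c * pair_seq p i = pair_seq (c * fst p, c * snd p) i"
  by (simp add: pair_seq_def)

text \<open>The norm is the one of the product type, hence the Euclidean norm; the supremum norm on
  pairs would not give the equality case exploited below.\<close>

definition C2_space :: "(nat \<Rightarrow> complex) normed_module" where
  "C2_space =
     \<lparr>carrier = range pair_seq,
      mult = (\<lambda>a b. a), one = pair_seq 0, zero = pair_seq 0,
      add = (\<lambda>a b i. a i + b i),
      smult = (\<lambda>c a i. c * a i),
      vnorm = (\<lambda>a. norm (a 0, a 1))\<rparr>"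

lemma norm_scale_pair: "norm (c * a, c * b) = cmod c * norm (a :: complex, b :: complex)"
  by (simp add: norm_prod_def norm_mult power_mult_distrib real_sqrt_mult flip: distrib_left)

lemma C2_simps:
  shows "carrier C2_space = range pair_seq"
    and "\<zero>\<^bsub>C2_space\<^esub> = pair_seq 0"
    and "pair_seq p \<oplus>\<^bsub>C2_space\<^esub> pair_seq q = pair_seq (p + q)"
    and "c \<odot>\<^bsub>C2_space\<^esub> pair_seq p = pair_seq (c * fst p, c * snd p)"
    and "vnorm C2_space (pair_seq p) = norm p"
  by (simp_all add: C2_space_def pair_seq_add pair_seq_mult)

lemma C2_complex_normed_space: "complex_normed_space C2_space"
proof (intro complex_normed_space.intro complex_normed_space_axioms.intro moduleI)
  show "cring complex_ring"
    by (intro cringI abelian_groupI comm_monoidI)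
      (auto simp: complex_ring_def algebra_simps intro: exI[of _ "- _"])
  show "abelian_group C2_space"
  proof (rule abelian_groupI)
    fix a assume "a \<in> carrier C2_space"
    then obtain p where "a = pair_seq p" by (auto simp: C2_simps)
    then show "\<exists>b\<in>carrier C2_space. b \<oplus>\<^bsub>C2_space\<^esub> a = \<zero>\<^bsub>C2_space\<^esub>"
      by (intro bexI[of _ "pair_seq (- p)"]) (simp_all add: C2_simps)
  qed (auto simp: C2_simps algebra_simps)
qed (auto simp: C2_simps complex_ring_def algebra_simps norm_scale_pair zero_prod_def
    norm_triangle_ineq[of "(a, b)" "(c, d)" for a b c d, simplified])

text \<open>Identifies the metric with that of \<open>complex \<times> complex\<close>, from which
  completeness and separability are transported.\<close>

lemma C2_vdist: "vdist C2_space (pair_seq p) (pair_seq q) = dist p q"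
proof -
  interpret C2: complex_normed_space C2_space by (rule C2_complex_normed_space)
  have "pair_seq p \<ominus>\<^bsub>C2_space\<^esub> pair_seq q = pair_seq (p - q)"
    by (simp add: C2.minus_eq_smult C2_simps prod_eq_iff)
  then show ?thesis
    by (simp add: vdist_def C2_simps dist_norm)
qed

lemma C2_separable_banach: "separable_complex_banach C2_space"
proof -
  interpret M: Metric_space "carrier C2_space" "vdist C2_space"
    by (rule complex_normed_space_Metric_space[OF C2_complex_normed_space])
  have "M.mcomplete"
    unfolding M.mcomplete_def
  proof (intro allI impI)
    fix \<sigma> assume \<sigma>: "M.MCauchy \<sigma>"
    then have "\<forall>n. \<sigma> n \<in> carrier C2_space" unfolding M.MCauchy_def by blast
    then have "\<forall>n. \<exists>p. \<sigma> n = pair_seq p" by (simp only: C2_simps(1) image_iff) blast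
    then obtain s where s: "\<sigma> n = pair_seq (s n)" for n by metis
    have "Cauchy s"
      using \<sigma> by (simp add: M.MCauchy_def Cauchy_def s C2_vdist)
    then obtain l where "s \<longlonglongrightarrow> l"
      by (auto simp: Cauchy_convergent_iff convergent_def)
    then have "limitin M.mtopology \<sigma> (pair_seq l) sequentially"
      unfolding M.limit_metric_sequentially by (auto simp: s C2_vdist C2_simps LIMSEQ_def)
    then show "\<exists>x. limitin M.mtopology \<sigma> x sequentially" by blast
  qed
  moreover have "separable_space M.mtopology"
  proof -
    obtain D :: "(complex \<times> complex) set" where D: "countable D"
      "\<forall>U. open U \<longrightarrow> U \<noteq> {} \<longrightarrow> (\<exists>d\<in>D. d \<in> U)"
      using countable_dense_exists by (elim exE conjE)
    have "\<exists>y\<in>pair_seq ` D. y \<in> M.mball x r" if x: "x \<in> carrier C2_space" and "r > 0" for x r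
    proof -
      obtain p where p: "x = pair_seq p" using x by (auto simp: C2_simps(1))
      obtain q where "q \<in> D" "dist p q < r"
        using spec[OF D(2), of "ball p r"] \<open>r > 0\<close> by auto
      then show ?thesis
        unfolding M.in_mball p by (intro bexI[of _ "pair_seq q"]) (simp_all add: C2_simps(1) C2_vdist)
    qed
    then have closure: "M.mtopology closure_of (pair_seq ` D) = carrier C2_space"
      unfolding M.metric_closure_of by blast
    have "pair_seq ` D \<subseteq> carrier C2_space" by (auto simp: C2_simps(1))
    with D(1) closure show ?thesis
      unfolding separable_space_def M.topspace_mtopology
      by (intro exI[of _ "pair_seq ` D"] conjI countable_image)
  qed
  ultimately show ?thesis
    by (simp add: separable_complex_banach_def C2_complex_normed_space)
qed

text \<open>If f and g are the images of the unit vectors, testing on (cnj f k, cnj g k) bounds the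
  Euclidean norm of (f k, g k) by 1; a point where t f + s g has modulus 1, for a real unit vector
  (t, s), then satisfies cmod (f k) = t by equality in the Cauchy--Schwarz inequality.\<close>

lemma interval_image_of_C2_isometry:
  assumes K: "compact_space K" and T: "linear_isometry C2_space (C_space K) T"
  shows "\<exists>u. continuous_map K euclideanreal u \<and> {0..1} \<subseteq> u ` topspace K"
proof -
  define f g where "f = T (pair_seq (1, 0))" and "g = T (pair_seq (0, 1))"
  have closed: "T (pair_seq p) \<in> carrier (C_space K)" for p
    using T by (auto simp: linear_isometry_def C2_simps)
  have cont: "continuous_map K euclidean (T (pair_seq p))" for p
    using closed[of p] by (simp add: C_space_def)
  have norm: "sup_norm K (T (pair_seq p)) = norm p" for p
  proof -
    have "\<forall>x\<in>carrier C2_space. vnorm (C_space K) (T x) = vnorm C2_space x"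
      using T unfolding linear_isometry_def by (elim conjE)
    from bspec[OF this, of "pair_seq p"] show ?thesis
      by (simp add: C2_simps C_space_def)
  qed
  have T_eq: "T (pair_seq (a, b)) k = a * f k + b * g k" if k: "k \<in> topspace K" for a b k
  proof -
    have "\<forall>x\<in>carrier C2_space. \<forall>y\<in>carrier C2_space.
        T (x \<oplus>\<^bsub>C2_space\<^esub> y) = T x \<oplus>\<^bsub>C_space K\<^esub> T y"
      and "\<forall>c. \<forall>x\<in>carrier C2_space. T (c \<odot>\<^bsub>C2_space\<^esub> x) = c \<odot>\<^bsub>C_space K\<^esub> T x"
      using T unfolding linear_isometry_def by blast+
    then have add: "T (pair_seq (p + q)) = T (pair_seq p) \<oplus>\<^bsub>C_space K\<^esub> T (pair_seq q)"
      and scale: "T (pair_seq (c * fst p, c * snd p)) = c \<odot>\<^bsub>C_space K\<^esub> T (pair_seq p)" for p q c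
      by (metis C2_simps(1,3) rangeI, metis C2_simps(1,4) rangeI)
    show ?thesis
      using add[of "(a, 0)" "(0, b)"] scale[of a "(1, 0)"] scale[of b "(0, 1)"] k
      by (simp add: C_space_def f_def g_def)
  qed
  \<comment> \<open>Compactness turns the supremum norm into a maximum, so every unit vector is
    normed at some point of K.\<close>
  have attained: "\<exists>k\<in>topspace K. cmod (T (pair_seq p) k) = 1 \<and>
      (\<forall>j\<in>topspace K. cmod (T (pair_seq p) j) \<le> 1)" if p: "norm p = 1" for p
  proof -
    have "topspace K \<noteq> {}" using norm[of p] p by (auto simp: sup_norm_def)
    let ?S = "(\<lambda>k. cmod (T (pair_seq p) k)) ` topspace K"
    have "continuous_map K euclideanreal (\<lambda>k. cmod (T (pair_seq p) k))"
      by (intro continuous_map_norm cont)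
    then have "compactin euclideanreal ?S"
      using K image_compactin unfolding compact_space_def by blast
    then have "compact ?S" by simp
    then obtain m where m: "m \<in> ?S" "\<forall>t\<in>?S. t \<le> m"
      using compact_attains_sup[of ?S] \<open>topspace K \<noteq> {}\<close> by auto
    then have "Sup ?S = m" by (intro cSup_eq_maximum) auto
    then have "m = 1" using norm[of p] p \<open>topspace K \<noteq> {}\<close> by (simp add: sup_norm_def)
    then show ?thesis using m by auto
  qed
  have ball: "(cmod (f k))\<^sup>2 + (cmod (g k))\<^sup>2 \<le> 1" if k: "k \<in> topspace K" for k
  proof (cases "f k = 0 \<and> g k = 0")
    case False
    define r where "r = norm (f k, g k)"
    have r: "r > 0" "r\<^sup>2 = (cmod (f k))\<^sup>2 + (cmod (g k))\<^sup>2"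
      using False by (auto simp: r_def norm_prod_def sum_power2_gt_zero_iff)
    \<comment> \<open>The unit vector at which the functional (a, b) \<mapsto> a f k + b g k attains
      its norm r. Testing there gives the value r itself, whence r is at most 1.\<close>
    define p where "p = (cnj (f k) / r, cnj (g k) / r)"
    have "norm p = 1"
    proof -
      have "(norm p)\<^sup>2 = ((cmod (f k))\<^sup>2 + (cmod (g k))\<^sup>2) / r\<^sup>2"
        using r(1) by (simp add: p_def norm_prod_def norm_divide power_divide add_divide_distrib)
      then have "(norm p)\<^sup>2 = 1\<^sup>2" using r(1) by (simp flip: r(2))
      then show ?thesis using power2_eq_imp_eq[of "norm p" 1] by simp
    qed
    from attained[OF this] k have "cmod (T (pair_seq p) k) \<le> 1" by blast
    moreover have "complex_of_real (r\<^sup>2) = f k * cnj (f k) + g k * cnj (g k)"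
      unfolding r(2) by (simp add: complex_norm_square del: of_real_power)
    then have "T (pair_seq p) k = complex_of_real (r\<^sup>2) / complex_of_real r"
      using T_eq[OF k, of "cnj (f k) / r" "cnj (g k) / r"]
      by (simp only: p_def) (simp add: add_divide_distrib mult.commute)
    then have "T (pair_seq p) k = complex_of_real r"
      using r(1) by (simp add: power2_eq_square)
    ultimately have "r \<le> 1" using r(1) by simp
    then have "r\<^sup>2 \<le> 1" using r(1) by (simp add: power_le_one)
    then show ?thesis using r(2) by simp
  qed simp
  have "\<exists>k\<in>topspace K. cmod (f k) = t" if t: "t \<in> {0..1}" for t
  proof -
    define s where "s = sqrt (1 - t\<^sup>2)"
    have "t\<^sup>2 \<le> 1" using t by (simp add: power_le_one)
    then have s: "s \<ge> 0" "s\<^sup>2 = 1 - t\<^sup>2" by (simp_all add: s_def)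
    have "norm (complex_of_real t, complex_of_real s) = 1"
      using s by (simp add: norm_prod_def)
    from attained[OF this] obtain k where k: "k \<in> topspace K"
      "cmod (T (pair_seq (complex_of_real t, complex_of_real s)) k) = 1"
      by blast
    then have "1 \<le> cmod (t * f k) + cmod (s * g k)"
      using T_eq[OF k(1)] norm_triangle_ineq[of "t * f k" "s * g k"] by simp
    then have "1 \<le> t * cmod (f k) + s * cmod (g k)"
      using t s by (simp add: norm_mult)
    then have "(1 + 1) - 2 * (t * cmod (f k) + s * cmod (g k)) \<le> 0" by simp
    \<comment> \<open>The vector (t, s) has norm 1, the vector of moduli has norm at most 1, and
      their inner product is at least 1. Expanding the squared distance shows that they
      coincide.\<close>
    moreover have "(t - cmod (f k))\<^sup>2 + (s - cmod (g k))\<^sup>2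
        = (t\<^sup>2 + s\<^sup>2) + ((cmod (f k))\<^sup>2 + (cmod (g k))\<^sup>2) - 2 * (t * cmod (f k) + s * cmod (g k))"
      by (simp add: power2_eq_square algebra_simps)
    then have "(t - cmod (f k))\<^sup>2 + (s - cmod (g k))\<^sup>2
        \<le> (1 + 1) - 2 * (t * cmod (f k) + s * cmod (g k))"
      using ball[OF k(1)] s(2) by simp
    ultimately have "(t - cmod (f k))\<^sup>2 + (s - cmod (g k))\<^sup>2 \<le> 0"
      by (rule order_trans[rotated])
    then have "t - cmod (f k) = 0"
      by (simp add: sum_power2_le_zero_iff)
    then show ?thesis using k(1) by (intro bexI[of _ k]) simp_all
  qed
  then have "{0..1} \<subseteq> (\<lambda>k. cmod (f k)) ` topspace K"
    by fast
  moreover have "continuous_map K euclideanreal (\<lambda>k. cmod (f k))"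
    using cont unfolding f_def by (rule continuous_map_norm)
  ultimately show ?thesis by (intro exI[of _ "\<lambda>k. cmod (f k)"] conjI)
qed

theorem theorem2p10:
  fixes K :: "'a topology"
  assumes "compact_space K" and "Hausdorff_space K"
  shows "((\<exists>P. perfect_set_in K P) \<longleftrightarrow>
           (\<forall>X :: (nat \<Rightarrow> complex) normed_module.
              separable_complex_banach X \<longrightarrow> contains_isometric_SPR_copy K X))
       \<and> ((\<exists>P. perfect_set_in K P) \<longrightarrow>
           (\<forall>X :: 'v normed_module.
              separable_complex_banach X \<longrightarrow> contains_isometric_SPR_copy K X))"
proof (intro conjI iffI impI allI)
  assume "\<forall>X :: (nat \<Rightarrow> complex) normed_module.
    separable_complex_banach X \<longrightarrow> contains_isometric_SPR_copy K X"
  from this[rule_format, OF C2_separable_banach]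
  obtain T where "linear_isometry C2_space (C_space K) T"
    unfolding contains_isometric_SPR_copy_def by (elim exE conjE)
  from interval_image_of_C2_isometry[OF assms(1) this]
  obtain u where "continuous_map K euclideanreal u" "{0..1} \<subseteq> u ` topspace K"
    by (elim exE conjE)
  then show "\<exists>P. perfect_set_in K P"
    by (rule perfect_set_of_interval_image[OF assms(1)])
qed (auto intro: isometric_SPR_copy_of_perfect_set[OF assms])

end
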